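(* Let $1<p<\infty$. There exists a constant $c=c(p)$, depending only on $p$, such that for every $n\ge1$, every cube $Q_0\subset\mathbb{R}^n$ and every $0<s\le\frac{1}{2^{n+3}}$ the following two statements hold. (a) For every $s\le r\le\frac12$, every $f\in JN^d_{p,0,s}(Q_0)$ and every $\lambda>0$, \[ |\{x\in Q_0:|f(x)-m_f^r(Q_0)|>\lambda\}|\le c\,\frac{\|f\|_{JN^d_{p,0,s}(Q_0)}^p}{\lambda^p}. \] (b) With the same constant $c$, for every measurable function $f:Q_0\to[-\infty,\infty]$, \[ s\,\|f\|_{JN^d_{p,0,s}(Q_0)}\le\|f\|_{JN^d_p(Q_0)}\le\frac{2cp}{p-1}\,\|f\|_{JN^d_{p,0,s}(Q_0)}. \]
   Context: $|A|$ denotes Lebesgue measure and $f_A=\frac1{|A|}\int_A f\,dx$ the integral average. A cube in $\mathbb{R}^n$ is a closed bounded cube $[a_1,b_1]\times\dots\times[a_n,b_n]$ with sides parallel to the coordinate axes and $b_1-a_1=\dots=b_n-a_n>0$. Dyadic subcubes: for a cube $Q_0$, $\mathcal{D}(Q_0)=\bigcup_{j=0}^\infty \mathcal{D}_j(Q_0)$, where $\mathcal{D}_j(Q_0)$ consists of the $2^{jn}$ closed cubes of side length $2^{-j}l(Q_0)$ ($l(Q_0)$ being the side length of $Q_0$), with pairwise disjoint interiors, obtained by dividing each side of $Q_0$ into $2^j$ equal parts. Elements of $\mathcal{D}(Q_0)$ are the dyadic subcubes of $Q_0$. Collections of dyadic cubes are called pairwise disjoint if their interiors are pairwise disjoint.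 Maximal median: for $0<s\le1$, a measurable set $A\subset\mathbb{R}^n$ with $0<|A|<\infty$ and a measurable $f:A\to[-\infty,\infty]$, \[ m_f^s(A)=\inf\{a\in\mathbb{R}: |\{x\in A: f(x)>a\}|<s|A|\} \] (with $\inf\emptyset=+\infty$). Median-type dyadic John--Nirenberg space: for $1<p<\infty$, $0<s\le\frac12$ and measurable $f:Q_0\to[-\infty,\infty]$, \[ \|f\|_{JN^d_{p,0,s}(Q_0)}^p=\sup\sum_{i}|Q_i|\Bigl(\inf_{c_i\in\mathbb{R}} m_{|f-c_i|}^s(Q_i)\Bigr)^p, \] and $f\in JN^d_{p,0,s}(Q_0)$ if this is finite. Dyadic John--Nirenberg space: for $1<p<\infty$ and $f\in L^1(Q_0)$, \[ \|f\|_{JN^d_{p}(Q_0)}^p=\sup\sum_{i}|Q_i|\Bigl(\frac1{|Q_i|}\int_{Q_i}|f-f_{Q_i}|\,dx\Bigr)^p, \] and $f\in JN^d_p(Q_0)$ if this is finite. Both suprema are over countable collections $\{Q_i\}$ of pairwise disjoint dyadic subcubes of $Q_0$. For measurable $f\notin L^1(Q_0)$ one sets $\|f\|_{JN^d_p(Q_0)}=\infty$. *)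

theory Defs
  imports "HOL-Analysis.Analysis"
begin

text \<open>
  The constant of the theorem is uniform in the dimension, so the dimension has to be a
  number rather than a type. Points of n-dimensional space are the elements of
  \<open>{..<n} \<rightarrow>\<^sub>E UNIV\<close>, the common underlying set of the product measure and of the
  product topology below. Lebesgue measure is the completion of the Borel product measure.
\<close>

abbreviation leb :: "nat \<Rightarrow> (nat \<Rightarrow> real) measure" where
  "leb n \<equiv> completion (Pi\<^sub>M {..<n} (\<lambda>_. lborel))"

abbreviation Rtop :: "nat \<Rightarrow> (nat \<Rightarrow> real) topology" where
  "Rtop n \<equiv> product_topology (\<lambda>_. euclideanreal) {..<n}"

definition cube :: "nat \<Rightarrow> (nat \<Rightarrow> real) \<Rightarrow> real \<Rightarrow> (nat \<Rightarrow> real) set" where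
  "cube n a l = (\<Pi>\<^sub>E i\<in>{..<n}. {a i .. a i + l})"

definition is_cube :: "nat \<Rightarrow> (nat \<Rightarrow> real) set \<Rightarrow> bool" where
  "is_cube n Q \<longleftrightarrow> (\<exists>a l. l > 0 \<and> Q = cube n a l)"

definition dyadic_gen :: "nat \<Rightarrow> (nat \<Rightarrow> real) set \<Rightarrow> nat \<Rightarrow> (nat \<Rightarrow> real) set set" where
  "dyadic_gen n Q0 j =
     {cube n (\<lambda>i. a i + real (k i) * (l / 2 ^ j)) (l / 2 ^ j) | a l (k :: nat \<Rightarrow> nat).
        l > 0 \<and> Q0 = cube n a l \<and> (\<forall>i<n. k i < 2 ^ j)}"

definition dyadic :: "nat \<Rightarrow> (nat \<Rightarrow> real) set \<Rightarrow> (nat \<Rightarrow> real) set set" where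
  "dyadic n Q0 = (\<Union>j. dyadic_gen n Q0 j)"

definition dyadic_families :: "nat \<Rightarrow> (nat \<Rightarrow> real) set \<Rightarrow> (nat \<Rightarrow> real) set set set" where
  "dyadic_families n Q0 =
     {C. C \<subseteq> dyadic n Q0 \<and> countable C \<and>
         pairwise (\<lambda>Q R. disjnt (Rtop n interior_of Q) (Rtop n interior_of R)) C}"

text \<open>
  A function on a set is represented by a total function of which only the values on the
  set are ever used; \<open>f\<close> is a measurable function on \<open>A\<close> if it belongs to \<open>meas_on n A\<close>.
\<close>

definition meas_on :: "nat \<Rightarrow> (nat \<Rightarrow> real) set \<Rightarrow> ((nat \<Rightarrow> real) \<Rightarrow> ereal) set" where
  "meas_on n A = borel_measurable (restrict_space (leb n) A)"

text \<open>The infimum is over real numbers but is taken in \<open>ereal\<close>, where \<open>Inf {} = \<infinity>\<close>.\<close>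

definition max_median ::
    "nat \<Rightarrow> real \<Rightarrow> ((nat \<Rightarrow> real) \<Rightarrow> ereal) \<Rightarrow> (nat \<Rightarrow> real) set \<Rightarrow> ereal" where
  "max_median n s f A =
     Inf (ereal ` {a :: real. emeasure (leb n) {x\<in>A. f x > ereal a}
                                < ennreal s * emeasure (leb n) A})"

text \<open>Real powers on \<open>[0, \<infinity>]\<close>, for exponents \<open>p > 0\<close>.\<close>

definition epowr :: "ennreal \<Rightarrow> real \<Rightarrow> ennreal" where
  "epowr x p = (if x = \<infinity> then \<infinity> else ennreal (enn2real x powr p))"

text \<open>
  The median of a nonnegative function is nonnegative when \<open>s \<le> 1\<close>, so \<open>e2ennreal\<close>, which
  truncates negative values to \<open>0\<close>, does not alter it.
\<close>

definition median_osc ::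
    "nat \<Rightarrow> real \<Rightarrow> ((nat \<Rightarrow> real) \<Rightarrow> ereal) \<Rightarrow> (nat \<Rightarrow> real) set \<Rightarrow> ennreal" where
  "median_osc n s f Q = e2ennreal (INF c::real. max_median n s (\<lambda>x. \<bar>f x - ereal c\<bar>) Q)"

definition JN_median_norm ::
    "nat \<Rightarrow> real \<Rightarrow> real \<Rightarrow> (nat \<Rightarrow> real) set \<Rightarrow> ((nat \<Rightarrow> real) \<Rightarrow> ereal) \<Rightarrow> ennreal" where
  "JN_median_norm n p s Q0 f =
     epowr (SUP C \<in> dyadic_families n Q0.
              \<Sum>\<^sub>\<infinity>Q\<in>C. emeasure (leb n) Q * epowr (median_osc n s f Q) p) (1 / p)"

definition JN_median ::
    "nat \<Rightarrow> real \<Rightarrow> real \<Rightarrow> (nat \<Rightarrow> real) set \<Rightarrow> ((nat \<Rightarrow> real) \<Rightarrow> ereal) set" where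
  "JN_median n p s Q0 = {f \<in> meas_on n Q0. JN_median_norm n p s Q0 f < \<infinity>}"

definition L1_on :: "nat \<Rightarrow> (nat \<Rightarrow> real) set \<Rightarrow> ((nat \<Rightarrow> real) \<Rightarrow> ereal) set" where
  "L1_on n A = {f \<in> meas_on n A. (\<integral>\<^sup>+x\<in>A. e2ennreal \<bar>f x\<bar> \<partial>leb n) < \<infinity>}"

text \<open>
  Only used for \<open>f\<close> in \<open>L1_on\<close>: such \<open>f\<close> is finite almost everywhere, so the convention
  that \<open>real_of_ereal\<close> maps infinite values to \<open>0\<close> does not affect the integral.
\<close>

definition avg :: "nat \<Rightarrow> ((nat \<Rightarrow> real) \<Rightarrow> ereal) \<Rightarrow> (nat \<Rightarrow> real) set \<Rightarrow> real" where
  "avg n f Q = (LINT x:Q|leb n. real_of_ereal (f x)) / measure (leb n) Q"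

definition mean_osc :: "nat \<Rightarrow> ((nat \<Rightarrow> real) \<Rightarrow> ereal) \<Rightarrow> (nat \<Rightarrow> real) set \<Rightarrow> ennreal" where
  "mean_osc n f Q =
     (\<integral>\<^sup>+x\<in>Q. e2ennreal \<bar>f x - ereal (avg n f Q)\<bar> \<partial>leb n) / emeasure (leb n) Q"

definition JN_norm ::
    "nat \<Rightarrow> real \<Rightarrow> (nat \<Rightarrow> real) set \<Rightarrow> ((nat \<Rightarrow> real) \<Rightarrow> ereal) \<Rightarrow> ennreal" where
  "JN_norm n p Q0 f =
     (if f \<in> L1_on n Q0
      then epowr (SUP C \<in> dyadic_families n Q0.
                    \<Sum>\<^sub>\<infinity>Q\<in>C. emeasure (leb n) Q * epowr (mean_osc n f Q) p) (1 / p)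
      else \<infinity>)"

end

(*
  Up to a null set the interiors of the dyadic cubes form a laminar family, so that each union of
  dyadic cubes is the disjoint union of its maximal members. For a real number m let A(t) be the
  measure of the union U_t of those dyadic cubes Q on at least half of which |f - m| > t; by a density
  argument A(t) dominates the measure of {|f - m| > t}. Consider the maximal cubes P that are not
  part of the family for t but have a child that is. If the median oscillation of P is below d, then f is
  close to a constant on all but s|P| of P, so U_(t + 2d) occupies at most 2s|P| of P, which is at most
  a quarter of the part occupied by U_t since s <= 2^(-n-3). The remaining P are controlled by
  the John-Nirenberg sum T, whence A(t + 2d) <= A(t)/4 + T/d^p. The choice t + 2d = 2^(1/p) t makes
  t^p A(t) contract by a factor 1/2 up to a multiple of T, with constants depending only on p. This is the weak type
  estimate. Integrating it over each cube of a family, and joining families of subcubes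
  of disjoint cubes, gives the bound of the JN_p norm; the reverse bound is Chebyshev's inequality.
*)
theory Submission
  imports Defs
begin

section \<open>A good-lambda inequality for laminar families\<close>

text \<open>Several obstacles shape the proof. Closed dyadic cubes share faces and are not laminar
  as sets, so the argument runs on their interiors; the faces are null. For a constant free of the
  dimension, \<open>n\<close> may enter only through the doubling constant
  \<open>\<kappa> = 2 ^ n\<close>, and that only in the product
  \<open>s * \<kappa> \<le> 1 / 8\<close>; with the half in the definition of heavy cubes this gives
  the quarter.

  The number \<open>m\<close> is fixed while the constants that approximate \<open>f\<close> change
  from cube to cube. They are compared with \<open>m\<close> through a single point: outside the
  heavy family, the set where \<open>f\<close> is far from \<open>m\<close> and the set where
  \<open>f\<close> is far from the local constant cannot cover a cube together.

  The whole cube has no parent. If it is heavy there is no stopping cube, and only then is the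
  median property of \<open>m\<close> used: it prevents the whole cube from having small
  oscillation, so the John-Nirenberg sum bounds its measure directly.

  Finally, nothing is known beforehand about the supremum of \<open>t powr p * A t\<close>, so
  nothing can be absorbed. The recursion is instead followed from \<open>t\<close> down to
  \<open>t / K ^ k\<close>, where the measure of the cube is a sufficient bound.\<close>

locale laminar_space = finite_measure M for M :: "'a measure" +
  fixes D :: "'a set set"
  assumes D_countable: "countable D"
    and D_sets: "Q \<in> D \<Longrightarrow> Q \<in> sets M"
    and D_pos: "Q \<in> D \<Longrightarrow> 0 < measure M Q"
    and space_in_D: "space M \<in> D"
    and laminar: "Q \<in> D \<Longrightarrow> R \<in> D \<Longrightarrow> Q \<subseteq> R \<or> R \<subseteq> Q \<or> Q \<inter> R = {}"
    and finite_supersets: "Q \<in> D \<Longrightarrow> finite {R \<in> D. Q \<subseteq> R}"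
begin

definition maximal :: "'a set set \<Rightarrow> 'a set set" where
  "maximal F = {Q \<in> F. \<forall>R\<in>F. Q \<subseteq> R \<longrightarrow> R = Q}"

lemma maximal_subset: "maximal F \<subseteq> F"
  by (auto simp: maximal_def)

lemma ex_maximal:
  assumes "F \<subseteq> D" "Q \<in> F"
  obtains R where "R \<in> maximal F" "Q \<subseteq> R"
proof -
  let ?S = "{R \<in> F. Q \<subseteq> R}"
  have "finite ?S"
    by (rule finite_subset[OF _ finite_supersets[of Q]]) (use assms in auto)
  moreover have "?S \<noteq> {}" using assms by auto
  ultimately obtain R where R: "R \<in> ?S" "\<And>S. S \<in> ?S \<Longrightarrow> R \<subseteq> S \<Longrightarrow> S = R"
    using finite_has_maximal[of ?S] by metis
  then have "R \<in> maximal F" by (auto simp: maximal_def)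
  with R that show thesis by auto
qed

lemma Union_maximal:
  assumes "F \<subseteq> D"
  shows "\<Union>(maximal F) = \<Union>F"
proof
  show "\<Union>(maximal F) \<subseteq> \<Union>F" using maximal_subset by blast
  show "\<Union>F \<subseteq> \<Union>(maximal F)"
  proof
    fix x assume "x \<in> \<Union>F"
    then obtain Q where "Q \<in> F" "x \<in> Q" by blast
    with ex_maximal[OF assms] show "x \<in> \<Union>(maximal F)" by (metis UnionI subsetD)
  qed
qed

lemma disjoint_maximal:
  assumes "F \<subseteq> D"
  shows "disjoint (maximal F)"
  unfolding disjoint_def
proof (intro ballI impI)
  fix Q R assume "Q \<in> maximal F" "R \<in> maximal F" "Q \<noteq> R"
  then show "Q \<inter> R = {}" using laminar[of Q R] assms by (auto simp: maximal_def)
qed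

lemma Union_sets: "F \<subseteq> D \<Longrightarrow> \<Union>F \<in> sets M"
  by (metis D_countable D_sets countable_subset sets.countable_Union subset_iff)

lemma measure_le_disjoint:
  assumes "C \<subseteq> D" "disjoint C" "A \<in> sets M" "B \<in> sets M" "0 \<le> k"
    and le: "\<And>Q. Q \<in> C \<Longrightarrow> measure M (A \<inter> Q) \<le> k * measure M (B \<inter> Q)"
  shows "measure M (A \<inter> \<Union>C) \<le> k * measure M (B \<inter> \<Union>C)"
proof -
  have C: "countable C" "\<And>Q. Q \<in> C \<Longrightarrow> Q \<in> sets M"
    using assms D_countable countable_subset D_sets by blast+
  \<comment> \<open>Additivity over \<open>C\<close> is expressed in \<open>ennreal\<close>, as an
    integral over the counting measure, so that no summability has to be checked for the real-valued
    measures.\<close>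
  have sum: "emeasure M (E \<inter> \<Union>C) = (\<integral>\<^sup>+Q. emeasure M (E \<inter> Q) \<partial>count_space C)" if "E \<in> sets M" for E
  proof -
    have "E \<inter> \<Union>C = \<Union>((\<inter>) E ` C)" by auto
    moreover have "disjoint_family_on ((\<inter>) E) C"
      using \<open>disjoint C\<close> by (auto simp: disjoint_family_on_def disjoint_def)
    ultimately show ?thesis
      using emeasure_UN_countable[of C "(\<inter>) E" M] C that by auto
  qed
  have "emeasure M (A \<inter> \<Union>C) \<le> (\<integral>\<^sup>+Q. ennreal k * emeasure M (B \<inter> Q) \<partial>count_space C)"
    unfolding sum[OF assms(3)]
    by (rule nn_integral_mono)
       (use le assms(5) in \<open>auto simp: emeasure_eq_measure simp flip: ennreal_mult\<close>)
  also have "\<dots> = ennreal k * emeasure M (B \<inter> \<Union>C)"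
    unfolding sum[OF assms(4)] by (rule nn_integral_cmult) auto
  finally show ?thesis
    using assms(5) by (simp add: emeasure_eq_measure flip: ennreal_mult)
qed

text \<open>Overlaps in \<open>F\<close> cost nothing: its maximal members are disjoint and have the
  same union. This is the covering argument behind the weak type bound of the dyadic maximal
  function.\<close>

lemma measure_Union_le:
  assumes "F \<subseteq> D" "B \<in> sets M" "0 \<le> k"
    and "\<And>Q. Q \<in> F \<Longrightarrow> measure M Q \<le> k * measure M (B \<inter> Q)"
  shows "measure M (\<Union>F) \<le> k * measure M (B \<inter> \<Union>F)"
proof -
  have "measure M (space M \<inter> \<Union>(maximal F)) \<le> k * measure M (B \<inter> \<Union>(maximal F))"
    using assms maximal_subset[of F] disjoint_maximal[of F] D_sets
    by (intro measure_le_disjoint) (auto simp: subset_iff Int_absorb1 sets.sets_into_space)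
  moreover have "space M \<inter> \<Union>F = \<Union>F"
    using Union_sets[OF assms(1)] sets.sets_into_space by blast
  ultimately show ?thesis using Union_maximal[OF assms(1)] by simp
qed

end

text \<open>For dyadic cubes \<open>\<kappa>\<close> is \<open>2 ^ n\<close>. The assumption
  \<open>density\<close> is a weak form of the Lebesgue density theorem; density above one half in a
  single cube is enough because a cube counts as heavy from one half on.\<close>

locale doubling_laminar_space = laminar_space M D for M :: "'a measure" and D +
  fixes \<kappa> :: real
  assumes parent: "Q \<in> D \<Longrightarrow> Q \<noteq> space M \<Longrightarrow> \<exists>P\<in>D. Q \<subset> P \<and> measure M P \<le> \<kappa> * measure M Q"
    and density: "Z \<in> sets M \<Longrightarrow> 0 < measure M Z \<Longrightarrow> \<exists>Q\<in>D. measure M Q < 2 * measure M (Z \<inter> Q)"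
begin

section \<open>Heavy cubes and the good-lambda inequality\<close>

context
  fixes f :: "'a \<Rightarrow> ereal" and s m :: real
  assumes f [measurable]: "f \<in> borel_measurable M"
    and s: "0 < s" "s \<le> 1 / 8" "s * \<kappa> \<le> 1 / 8"
begin

definition dev :: "real \<Rightarrow> real \<Rightarrow> 'a set" where
  "dev c t = {x \<in> space M. \<bar>f x - ereal c\<bar> > ereal t}"

lemma dev_sets [measurable, simp]: "dev c t \<in> sets M"
  unfolding dev_def by measurable

lemma dev_mono: "t \<le> u \<Longrightarrow> dev c u \<subseteq> dev c t"
  unfolding dev_def by auto (meson ereal_less_eq(3) le_less_trans)

lemma dev_triangle:
  assumes "\<bar>c - b\<bar> \<le> d"
  shows "dev b (d + t) \<subseteq> dev c t"
proof
  fix x assume "x \<in> dev b (d + t)"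
  with assms show "x \<in> dev c t" unfolding dev_def
    by (cases "f x") auto
qed

text \<open>Tightness at level \<open>d\<close> lies between median oscillation \<open>< d\<close> and median oscillation \<open>\<le> d\<close>.\<close>

definition tight :: "real \<Rightarrow> 'a set \<Rightarrow> bool" where
  "tight d Q \<longleftrightarrow> (\<exists>c. measure M (dev c d \<inter> Q) < s * measure M Q)"

definition heavy :: "real \<Rightarrow> 'a set set" where
  "heavy t = {Q \<in> D. measure M Q \<le> 2 * measure M (dev m t \<inter> Q)}"

lemma heavy_subset: "heavy t \<subseteq> D"
  by (auto simp: heavy_def)

lemma heavy_sets: "Q \<in> heavy t \<Longrightarrow> Q \<in> sets M"
  using D_sets by (auto simp: heavy_def)

lemma heavy_antimono:
  assumes "t \<le> u"
  shows "heavy u \<subseteq> heavy t"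
proof
  fix Q assume Q: "Q \<in> heavy u"
  have "measure M (dev m u \<inter> Q) \<le> measure M (dev m t \<inter> Q)"
    by (rule finite_measure_mono) (use dev_mono[OF assms, of m] heavy_sets[OF Q] in auto)
  with Q show "Q \<in> heavy t" by (auto simp: heavy_def)
qed

text \<open>If the part of the level set outside the heavy cubes had positive measure, it would fill
  more than half of some cube. That cube would be heavy, hence disjoint from this very part.\<close>

lemma measure_dev_le: "measure M (dev m t) \<le> measure M (\<Union>(heavy t))"
proof -
  have U: "\<Union>(heavy t) \<in> sets M" by (rule Union_sets[OF heavy_subset])
  let ?Z = "dev m t - \<Union>(heavy t)"
  have "\<not> 0 < measure M ?Z"
  proof
    assume "0 < measure M ?Z"
    then obtain Q where Q: "Q \<in> D" "measure M Q < 2 * measure M (?Z \<inter> Q)"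
      using density[of ?Z] U by auto
    have "measure M (?Z \<inter> Q) \<le> measure M (dev m t \<inter> Q)"
      by (rule finite_measure_mono) (use Q D_sets in auto)
    with Q have "Q \<in> heavy t" by (auto simp: heavy_def)
    then have "?Z \<inter> Q = {}" by auto
    with Q D_pos show False by (simp add: not_less less_imp_le)
  qed
  then have "measure M ?Z = 0" using zero_less_measure_iff by blast
  moreover have "measure M (dev m t) \<le> measure M (?Z \<union> \<Union>(heavy t))"
    by (rule finite_measure_mono) (use U in auto)
  moreover have "\<dots> \<le> measure M ?Z + measure M (\<Union>(heavy t))"
    by (rule measure_Un_le) (use U in auto)
  ultimately show ?thesis by simp
qed

text \<open>The points of \<open>P\<close> with \<open>f\<close> far from \<open>c\<close> make up
  less than an eighth of \<open>P\<close>, those with \<open>f\<close> far from \<open>m\<close>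
  less than a half. Some \<open>x\<close> in \<open>P\<close> avoids both, so \<open>c\<close> and
  \<open>m\<close> differ by at most \<open>t + d\<close>, and deviation above
  \<open>t + 2 * d\<close> from \<open>m\<close> forces deviation above \<open>d\<close> from
  \<open>c\<close>. The factor 2 is the price of passing from this set to the heavy cubes.\<close>

lemma good_lambda_cube:
  assumes P: "P \<in> D" "P \<notin> heavy t" "tight d P"
  shows "measure M (\<Union>{Q \<in> heavy (t + 2 * d). Q \<subseteq> P}) \<le> 2 * s * measure M P"
proof -
  let ?F = "{Q \<in> heavy (t + 2 * d). Q \<subseteq> P}"
  obtain c where c: "measure M (dev c d \<inter> P) < s * measure M P"
    using P(3) by (auto simp: tight_def)
  have Ps: "P \<in> sets M" using P D_sets by auto
  have "\<not> P \<subseteq> dev c d \<union> dev m t"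
  proof
    assume sub: "P \<subseteq> dev c d \<union> dev m t"
    have "measure M P \<le> measure M ((dev c d \<inter> P) \<union> (dev m t \<inter> P))"
      by (rule finite_measure_mono) (use sub Ps in auto)
    also have "\<dots> \<le> measure M (dev c d \<inter> P) + measure M (dev m t \<inter> P)"
      by (rule measure_Un_le) (use Ps in auto)
    also have "\<dots> < s * measure M P + measure M P / 2"
      using c P by (auto simp: heavy_def)
    also have "\<dots> \<le> 1/8 * measure M P + measure M P / 2"
      using s by (intro add_right_mono mult_right_mono) auto
    finally show False by (simp add: D_pos P(1) less_imp_le not_less)
  qed
  then obtain x where x: "x \<in> P" "x \<in> space M" "x \<notin> dev c d" "x \<notin> dev m t"
    using Ps sets.sets_into_space by blast
  then have "\<bar>c - m\<bar> \<le> t + d"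
    by (cases "f x") (auto simp: dev_def)
  then have "dev m (t + d + d) \<subseteq> dev c d" by (intro dev_triangle) auto
  then have sub: "dev m (t + 2 * d) \<subseteq> dev c d" by (simp add: algebra_simps)
  have FD: "?F \<subseteq> D" using heavy_subset by auto
  have "measure M (\<Union>?F) \<le> 2 * measure M (dev c d \<inter> \<Union>?F)"
  proof (rule measure_Union_le[OF FD])
    fix Q assume Q: "Q \<in> ?F"
    have "measure M (dev m (t + 2 * d) \<inter> Q) \<le> measure M (dev c d \<inter> Q)"
      by (rule finite_measure_mono) (use sub Q heavy_sets in auto)
    with Q show "measure M Q \<le> 2 * measure M (dev c d \<inter> Q)"
      by (auto simp: heavy_def)
  qed auto
  also have "measure M (dev c d \<inter> \<Union>?F) \<le> measure M (dev c d \<inter> P)"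
    by (rule finite_measure_mono) (use Ps in auto)
  finally show ?thesis using c by auto
qed

lemma good_lambda:
  assumes top: "space M \<notin> heavy t" and d: "0 \<le> d"
    and loose: "\<And>C. C \<subseteq> D \<Longrightarrow> disjoint C \<Longrightarrow> (\<And>Q. Q \<in> C \<Longrightarrow> \<not> tight d Q) \<Longrightarrow> measure M (\<Union>C) \<le> S"
  shows "measure M (\<Union>(heavy (t + 2 * d))) \<le> measure M (\<Union>(heavy t)) / 4 + S"
proof -
  let ?U = "\<Union>(heavy t)" and ?V = "\<Union>(heavy (t + 2 * d))"
  have U: "?U \<in> sets M" and V: "?V \<in> sets M" using Union_sets heavy_subset by auto
  \<comment> \<open>The two conditions serve opposite purposes. Not being heavy makes
    \<open>good_lambda_cube\<close> applicable to \<open>P\<close>; the heavy \<open>Q\<close>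
    inside bounds \<open>measure M P\<close> by \<open>\<kappa>\<close> times the measure of the
    part of \<open>?U\<close> in \<open>P\<close>.\<close>
  define \<P> where "\<P> = {P \<in> D. P \<notin> heavy t \<and> (\<exists>Q\<in>heavy t. Q \<subseteq> P \<and> measure M P \<le> \<kappa> * measure M Q)}"
  have PD: "\<P> \<subseteq> D" by (auto simp: \<P>_def)
  define G where "G = {P \<in> maximal \<P>. tight d P}"
  define B where "B = {P \<in> maximal \<P>. \<not> tight d P}"
  have GB: "G \<subseteq> D" "B \<subseteq> D" "disjoint G" "disjoint B" "G \<subseteq> \<P>"
    using maximal_subset[of \<P>] PD disjoint_maximal[OF PD]
    by (auto simp: G_def B_def disjoint_def)
  \<comment> \<open>The parent of a maximal heavy cube is not heavy and so belongs to
    \<open>\<P>\<close>; \<open>top\<close> ensures that the parent exists.\<close>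
  have cover: "\<exists>P\<in>maximal \<P>. Q \<subseteq> P" if Q: "Q \<in> heavy (t + 2 * d)" for Q
  proof -
    have "Q \<in> heavy t" using Q heavy_antimono[of t "t + 2 * d"] d by auto
    then obtain R where R: "R \<in> maximal (heavy t)" "Q \<subseteq> R" using ex_maximal[OF heavy_subset] by metis
    then have Rt: "R \<in> heavy t" "R \<in> D" using maximal_subset heavy_subset by blast+
    with top have "R \<noteq> space M" by auto
    with parent[OF Rt(2)] obtain P where P: "P \<in> D" "R \<subset> P" "measure M P \<le> \<kappa> * measure M R" by auto
    then have "P \<notin> heavy t" using R by (auto simp: maximal_def)
    then have "P \<in> \<P>" using P Rt by (auto simp: \<P>_def)
    then obtain P' where "P' \<in> maximal \<P>" "P \<subseteq> P'" using ex_maximal[OF PD] by metis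
    then show ?thesis using R P by blast
  qed
  have "measure M (?V \<inter> \<Union>G) \<le> 1/4 * measure M (?U \<inter> \<Union>G)"
  proof (rule measure_le_disjoint[OF GB(1,3) V U])
    fix P assume PG: "P \<in> G"
    then have P: "P \<in> D" "P \<notin> heavy t" "tight d P" "P \<in> maximal \<P>" using GB(5) by (auto simp: \<P>_def G_def)
    obtain Q where Q: "Q \<in> heavy t" "Q \<subseteq> P" "measure M P \<le> \<kappa> * measure M Q"
      using PG GB(5) by (auto simp: \<P>_def)
    \<comment> \<open>A heavy cube for \<open>t + 2 * d\<close> that meets \<open>P\<close> lies in
      some maximal member of \<open>\<P>\<close>. These are disjoint, so it lies in \<open>P\<close>
      itself.\<close>
    have "?V \<inter> P \<subseteq> \<Union>{Q \<in> heavy (t + 2 * d). Q \<subseteq> P}"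
    proof
      fix x assume "x \<in> ?V \<inter> P"
      then obtain R where R: "R \<in> heavy (t + 2 * d)" "x \<in> R" "x \<in> P" by auto
      with cover obtain P' where P': "P' \<in> maximal \<P>" "R \<subseteq> P'" by blast
      then have "P' = P" using disjoint_maximal[OF PD] R P by (auto simp: disjoint_def)
      with R P' show "x \<in> \<Union>{Q \<in> heavy (t + 2 * d). Q \<subseteq> P}" by auto
    qed
    then have "measure M (?V \<inter> P) \<le> measure M (\<Union>{Q \<in> heavy (t + 2 * d). Q \<subseteq> P})"
      by (rule finite_measure_mono) (intro Union_sets, use heavy_subset in auto)
    also have "\<dots> \<le> 2 * s * measure M P" by (rule good_lambda_cube[OF P(1-3)])
    also have "\<dots> \<le> 2 * s * (\<kappa> * measure M Q)" using Q s by (intro mult_left_mono) auto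
    also have "\<dots> = 2 * (s * \<kappa>) * measure M Q" by simp
    also have "\<dots> \<le> 2 * (1/8) * measure M Q" using s by (intro mult_right_mono mult_left_mono) auto
    also have "measure M Q \<le> measure M (?U \<inter> P)"
      by (rule finite_measure_mono) (use Q U P(1) D_sets in auto)
    finally show "measure M (?V \<inter> P) \<le> 1/4 * measure M (?U \<inter> P)" by simp
  qed auto
  also have "measure M (?U \<inter> \<Union>G) \<le> measure M ?U"
    by (rule finite_measure_mono) (use U in auto)
  finally have 1: "measure M (?V \<inter> \<Union>G) \<le> measure M ?U / 4" by simp
  have 2: "measure M (\<Union>B) \<le> S"
    by (rule loose) (use GB in \<open>auto simp: B_def\<close>)
  have sets: "\<Union>G \<in> sets M" "\<Union>B \<in> sets M" using GB Union_sets by auto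
  have "?V \<subseteq> (?V \<inter> \<Union>G) \<union> \<Union>B"
    using cover by (fastforce simp: G_def B_def)
  then have "measure M ?V \<le> measure M ((?V \<inter> \<Union>G) \<union> \<Union>B)"
    by (rule finite_measure_mono) (use V sets in auto)
  also have "\<dots> \<le> measure M (?V \<inter> \<Union>G) + measure M (\<Union>B)"
    by (rule measure_Un_le) (use V sets in auto)
  finally show ?thesis using 1 2 by simp
qed

text \<open>The hypothesis \<open>m\<close> says that \<open>m\<close> is within \<open>d\<close> of
  every constant that approximates \<open>f\<close> up to \<open>d\<close> outside an
  \<open>s\<close>-fraction of the space; all the medians in question satisfy it. The hypothesis
  \<open>loose\<close> is Chebyshev's inequality for a John-Nirenberg sum bounded by
  \<open>T\<close>.\<close>

proposition weak_type:
  assumes p: "1 < p" and T: "0 \<le> T" and t: "0 < t"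
    and m: "\<And>c d. measure M (dev c d) < s * measure M (space M) \<Longrightarrow> \<bar>c - m\<bar> \<le> d"
    and loose: "\<And>C d. C \<subseteq> D \<Longrightarrow> disjoint C \<Longrightarrow> 0 < d \<Longrightarrow> (\<And>Q. Q \<in> C \<Longrightarrow> \<not> tight d Q) \<Longrightarrow>
      measure M (\<Union>C) \<le> T / d powr p"
  shows "measure M (dev m t) \<le> 4 * (2 / (2 powr (1 / p) - 1)) powr p * T / t powr p"
proof -
  define K :: real where "K = 2 powr (1 / p)"
  have K: "1 < K" "K \<le> 2" "K powr p = 2"
    using p powr_mono[of "1/p" 1 2] by (auto simp: K_def powr_powr)
  define A where "A u = measure M (\<Union>(heavy u))" for u
  have step: "A (K * u) \<le> A u / 4 + T / ((K - 1) * u / 2) powr p" if u: "0 < u" for u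
  proof (cases "space M \<in> heavy u")
    case True
    \<comment> \<open>Tightness of the whole space would, by \<open>m\<close>, keep the deviation
      from \<open>m\<close> above \<open>u\<close> to less than an eighth of it, whereas heaviness
      demands a half.\<close>
    have "\<not> tight (u / 2) (space M)"
    proof
      assume "tight (u / 2) (space M)"
      then obtain c where c: "measure M (dev c (u / 2)) < s * measure M (space M)"
        by (auto simp: tight_def Int_absorb2 sets.sets_into_space)
      then have "\<bar>c - m\<bar> \<le> u / 2" by (rule m)
      then have "dev m (u / 2 + u / 2) \<subseteq> dev c (u / 2)" by (rule dev_triangle)
      then have "measure M (dev m u) \<le> measure M (dev c (u / 2))"
        by (intro finite_measure_mono) auto
      also note c
      also have "s * measure M (space M) \<le> 1 / 8 * measure M (space M)"
        using s by (intro mult_right_mono) auto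
      finally have "measure M (dev m u) < 1 / 8 * measure M (space M)" .
      moreover have "measure M (space M) \<le> 2 * measure M (dev m u)"
        using True by (auto simp: heavy_def Int_absorb2 sets.sets_into_space)
      ultimately show False using D_pos[OF space_in_D] by simp
    qed
    then have "measure M (\<Union>{space M}) \<le> T / (u / 2) powr p"
      by (intro loose) (use u space_in_D in auto)
    moreover have "A (K * u) \<le> measure M (space M)" unfolding A_def by (rule bounded_measure)
    \<comment> \<open>Since \<open>K \<le> 2\<close>, the level \<open>(K - 1) * u / 2\<close> is at
      most \<open>u / 2\<close>; both cases thus end in the same bound.\<close>
    moreover have "T / (u / 2) powr p \<le> T / ((K - 1) * u / 2) powr p"
      using K u T p by (intro divide_left_mono powr_mono2) (auto simp: mult_le_cancel_right2)
    moreover have "0 \<le> A u" by (simp add: A_def)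
    ultimately show ?thesis by simp
  next
    case False
    have "measure M (\<Union>(heavy (u + 2 * ((K - 1) * u / 2)))) \<le> A u / 4 + T / ((K - 1) * u / 2) powr p"
      unfolding A_def by (rule good_lambda[OF False]) (use u K loose in auto)
    moreover have "u + 2 * ((K - 1) * u / 2) = K * u" by (simp add: field_simps)
    ultimately show ?thesis by (simp add: A_def)
  qed
  define E where "E = (2 / (K - 1)) powr p * T"
  \<comment> \<open>As \<open>K powr p = 2\<close>, the weight doubles and the quarter of
    \<open>step\<close> turns into a half.\<close>
  have step': "(K * u) powr p * A (K * u) \<le> (u powr p * A u) / 2 + 2 * E" if u: "0 < u" for u
  proof -
    have "(K * u) powr p * A (K * u) \<le> (K * u) powr p * (A u / 4 + T / ((K - 1) * u / 2) powr p)"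
      by (intro mult_left_mono step u) auto
    also have "(K * u) powr p = 2 * u powr p" using K u by (simp add: powr_mult)
    also have "((K - 1) * u / 2) powr p = u powr p / (2 / (K - 1)) powr p"
      using K u by (simp add: powr_mult powr_divide)
    also have "2 * u powr p * (A u / 4 + T / (u powr p / (2 / (K - 1)) powr p)) = u powr p * A u / 2 + 2 * E"
    proof -
      have "2 * b * (v / 4 + T / (b / q)) = b * v / 2 + 2 * (q * T)" if "0 < b" for b v q :: real
        using that by (simp add: field_simps)
      then show ?thesis using u by (simp add: E_def)
    qed
    finally show ?thesis using K u by (simp add: powr_mult)
  qed
  have E: "0 \<le> E" using T by (simp add: E_def)
  \<comment> \<open>The levels decrease with \<open>k\<close>: each step trades a level for a
    smaller one at half the weight, so the a priori bound by the measure of the space is eventually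
    multiplied by \<open>1 / 2 ^ k\<close>.\<close>
  define B where "B k = (t / K ^ k) powr p * A (t / K ^ k)" for k :: nat
  have B_Suc: "B k \<le> B (Suc k) / 2 + 2 * E" for k
  proof -
    have "t / K ^ k = K * (t / K ^ Suc k)" using K by simp
    then show ?thesis using step'[of "t / K ^ Suc k"] t K unfolding B_def by simp
  qed
  \<comment> \<open>The errors \<open>2 * E / 2 ^ i\<close> for \<open>i < k\<close> add up to
    \<open>4 * E * (1 - 1 / 2 ^ k)\<close>.\<close>
  have iter: "B 0 \<le> B k / 2 ^ k + 4 * E * (1 - 1 / 2 ^ k)" for k
  proof (induction k)
    case (Suc k)
    have "B k / 2 ^ k \<le> (B (Suc k) / 2 + 2 * E) / 2 ^ k"
      by (intro divide_right_mono B_Suc) auto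
    with Suc.IH show ?case by (simp add: field_simps)
  qed simp
  have bound: "B 0 \<le> t powr p * measure M (space M) * (1 / 2) ^ k + 4 * E" for k
  proof -
    have "t / K ^ k \<le> t"
      using t K by (simp add: divide_le_eq)
    then have "B k \<le> t powr p * measure M (space M)" unfolding B_def A_def
      using t K p by (intro mult_mono powr_mono2 bounded_measure) auto
    then have "B k / 2 ^ k \<le> t powr p * measure M (space M) / 2 ^ k"
      by (intro divide_right_mono) auto
    moreover have "4 * E * (1 - 1 / 2 ^ k) \<le> 4 * E" using E by (intro mult_left_le) auto
    ultimately show ?thesis using iter[of k] by (simp add: power_one_over)
  qed
  have "(\<lambda>k. t powr p * measure M (space M) * (1 / 2) ^ k + 4 * E) \<longlonglongrightarrow>
      t powr p * measure M (space M) * 0 + 4 * E"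
    by (intro tendsto_intros LIMSEQ_power_zero) auto
  then have "t powr p * measure M (space M) * 0 + 4 * E \<ge> B 0"
    by (rule LIMSEQ_le_const) (use bound in blast)
  then have "t powr p * A t \<le> 4 * E" by (simp add: B_def)
  moreover have "t powr p * measure M (dev m t) \<le> t powr p * A t"
    unfolding A_def by (intro mult_left_mono measure_dev_le) auto
  ultimately have "measure M (dev m t) * t powr p \<le> 4 * E" by (simp add: mult.commute)
  then have "measure M (dev m t) \<le> 4 * E / t powr p"
    using t by (subst pos_le_divide_eq) auto
  then show ?thesis by (simp add: E_def K_def)
qed

end
end

section \<open>Dyadic cubes\<close>

declare emeasure_completion [simp del]

definition open_cube :: "nat \<Rightarrow> (nat \<Rightarrow> real) \<Rightarrow> real \<Rightarrow> (nat \<Rightarrow> real) set" where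
  "open_cube n a l = (\<Pi>\<^sub>E i\<in>{..<n}. {a i <..< a i + l})"

definition grid_cube :: "nat \<Rightarrow> (nat \<Rightarrow> real) \<Rightarrow> real \<Rightarrow> nat \<Rightarrow> (nat \<Rightarrow> nat) \<Rightarrow> (nat \<Rightarrow> real) set" where
  "grid_cube n a l j k = open_cube n (\<lambda>i. a i + real (k i) * (l / 2 ^ j)) (l / 2 ^ j)"

text \<open>These are the interiors of the dyadic subcubes, see \<open>grid_eq_interior\<close>.
  Open grid cubes that meet are nested, whereas closed ones may meet in a face only.\<close>

definition grid :: "nat \<Rightarrow> (nat \<Rightarrow> real) \<Rightarrow> real \<Rightarrow> (nat \<Rightarrow> real) set set" where
  "grid n a l = {grid_cube n a l j k | j k. \<forall>i<n. k i < 2 ^ j}"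

lemma open_cube_cong:
  "(\<And>i. i < n \<Longrightarrow> a i = b i) \<Longrightarrow> open_cube n a l = open_cube n b l"
  unfolding open_cube_def by (intro PiE_cong) auto

lemma cube_cong:
  "(\<And>i. i < n \<Longrightarrow> a i = b i) \<Longrightarrow> cube n a l = cube n b l"
  unfolding cube_def by (intro PiE_cong) auto

text \<open>\<open>dyadic_gen\<close> quantifies over all representations of the cube by a corner
  and a side. Their uniqueness allows one representation to be fixed; in dimension 0 the side would
  not be determined.\<close>

lemma cube_eq_cube_iff:
  assumes "1 \<le> n" "0 < l" "0 < l'"
  shows "cube n a l = cube n a' l' \<longleftrightarrow> l = l' \<and> (\<forall>i<n. a i = a' i)"
proof
  assume "cube n a l = cube n a' l'"
  then have eq: "{a i .. a i + l} = {a' i .. a' i + l'}" if "i < n" for i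
    using that assms by (subst (asm) cube_def, subst (asm) cube_def, subst (asm) PiE_eq_iff_not_empty) auto
  then have "a i = a' i \<and> l = l'" if "i < n" for i
    using eq[OF that] assms unfolding Icc_eq_Icc by auto
  then show "l = l' \<and> (\<forall>i<n. a i = a' i)" using assms by auto
qed (metis cube_cong)

lemma interior_of_cube: "Rtop n interior_of cube n a l = open_cube n a l"
proof (rule interior_of_unique)
  show "open_cube n a l \<subseteq> cube n a l"
    unfolding open_cube_def cube_def by (intro PiE_mono) auto
  show "openin (Rtop n) (open_cube n a l)"
    unfolding open_cube_def by (simp add: openin_PiE open_openin[symmetric])
  fix T assume T: "T \<subseteq> cube n a l" "openin (Rtop n) T"
  show "T \<subseteq> open_cube n a l"
  proof
    fix x assume x: "x \<in> T"
    then obtain U where U: "\<forall>i\<in>{..<n}. openin euclideanreal (U i)" "x \<in> Pi\<^sub>E {..<n} U" "Pi\<^sub>E {..<n} U \<subseteq> T"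
      using T(2) unfolding openin_product_topology_alt by blast
    have "x i \<in> {a i <..< a i + l}" if i: "i < n" for i
    proof -
      \<comment> \<open>Changing only coordinate \<open>i\<close> of \<open>x\<close> stays inside
        the basic box, so the whole factor \<open>U i\<close> lies in the closed interval.\<close>
      have "U i \<subseteq> {a i .. a i + l}"
      proof
        fix y assume "y \<in> U i"
        then have "x(i := y) \<in> Pi\<^sub>E {..<n} U" using U(2) i by (auto simp: PiE_iff extensional_def)
        then have "x(i := y) \<in> cube n a l" using U(3) T(1) by auto
        then show "y \<in> {a i .. a i + l}" using i unfolding cube_def by (auto simp: PiE_iff split: if_splits)
      qed
      moreover have "open (U i)" using U(1) i by (simp add: open_openin[symmetric])
      ultimately have "U i \<subseteq> interior {a i .. a i + l}" by (rule interior_maximal)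
      then show ?thesis using U(2) i by (auto simp: PiE_iff)
    qed
    then show "x \<in> open_cube n a l" using U(2) by (auto simp: open_cube_def PiE_iff)
  qed
qed

lemma dyadic_cube_eq:
  assumes "1 \<le> n" "0 < l"
  shows "dyadic n (cube n a l) =
    {cube n (\<lambda>i. a i + real (k i) * (l / 2 ^ j)) (l / 2 ^ j) | j k. \<forall>i<n. k i < 2 ^ j}"
proof (intro equalityI subsetI)
  fix Q assume "Q \<in> dyadic n (cube n a l)"
  then obtain j k b l' where Q: "Q = cube n (\<lambda>i. b i + real (k i) * (l' / 2 ^ j)) (l' / 2 ^ j)"
     "0 < l'" "cube n a l = cube n b l'" "\<forall>i<n. k i < 2 ^ j"
    unfolding dyadic_def dyadic_gen_def by blast
  then have ab: "l = l'" "\<forall>i<n. a i = b i" using cube_eq_cube_iff[of n l l' a b] assms by auto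
  then have "Q = cube n (\<lambda>i. a i + real (k i) * (l / 2 ^ j)) (l / 2 ^ j)"
    unfolding Q(1) ab(1) by (intro cube_cong) (use ab in auto)
  then show "Q \<in> {cube n (\<lambda>i. a i + real (k i) * (l / 2 ^ j)) (l / 2 ^ j) | j k. \<forall>i<n. k i < 2 ^ j}"
    using Q(4) by blast
qed (use assms in \<open>auto simp: dyadic_def dyadic_gen_def\<close>)

lemma grid_eq_interior:
  assumes "1 \<le> n" "0 < l"
  shows "grid n a l = (\<lambda>Q. Rtop n interior_of Q) ` dyadic n (cube n a l)"
  unfolding dyadic_cube_eq[OF assms] grid_def grid_cube_def
  by (auto simp flip: interior_of_cube)

lemma emeasure_PiE_leb:
  assumes "\<And>i. i < n \<Longrightarrow> A i \<in> sets borel"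
  shows "emeasure (leb n) (Pi\<^sub>E {..<n} A) = (\<Prod>i<n. emeasure lborel (A i))"
proof -
  interpret product_sigma_finite "\<lambda>_. lborel :: real measure" ..
  show ?thesis using assms by (subst emeasure_completion) (auto intro: emeasure_PiM sets_PiM_I_finite)
qed

lemma sets_PiE_leb: "(\<And>i. i < n \<Longrightarrow> A i \<in> sets borel) \<Longrightarrow> Pi\<^sub>E {..<n} A \<in> sets (leb n)"
  by (auto intro!: sets_completionI_sets sets_PiM_I_finite)

lemma cube_sets [measurable]: "cube n a l \<in> sets (leb n)"
  and open_cube_sets [measurable]: "open_cube n a l \<in> sets (leb n)"
  unfolding cube_def open_cube_def by (auto intro: sets_PiE_leb)

lemma emeasure_cube: "0 < l \<Longrightarrow> emeasure (leb n) (cube n a l) = ennreal (l ^ n)"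
  unfolding cube_def by (subst emeasure_PiE_leb) (auto simp: ennreal_power)

lemma emeasure_open_cube: "0 < l \<Longrightarrow> emeasure (leb n) (open_cube n a l) = ennreal (l ^ n)"
  unfolding open_cube_def by (subst emeasure_PiE_leb) (auto simp: ennreal_power)

lemma open_cube_subset: "open_cube n a l \<subseteq> cube n a l"
  by (metis interior_of_cube interior_of_subset)

lemma cube_diff_null:
  assumes "0 < l"
  shows "cube n a l - open_cube n a l \<in> null_sets (leb n)"
proof -
  have "emeasure (leb n) (cube n a l - open_cube n a l) = 0"
    by (subst emeasure_Diff)
       (use assms in \<open>auto simp: emeasure_cube emeasure_open_cube open_cube_subset\<close>)
  then show ?thesis by auto
qed

lemma mem_grid_cube:
  "x \<in> grid_cube n a l j k \<longleftrightarrow> x \<in> extensional {..<n} \<and>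
    (\<forall>i<n. a i + real (k i) * (l / 2 ^ j) < x i \<and> x i < a i + real (k i + 1) * (l / 2 ^ j))"
proof -
  have "a i + real (k i + 1) * (l / 2 ^ j) = a i + real (k i) * (l / 2 ^ j) + l / 2 ^ j" for i
    by (simp add: distrib_right add_divide_distrib)
  then show ?thesis unfolding grid_cube_def open_cube_def PiE_iff by (auto simp: add.assoc)
qed

text \<open>A coarse side consists of \<open>d\<close> fine ones. A common point gives
  \<open>k i * d < k' i + 1\<close> and \<open>k' i < (k i + 1) * d\<close>; since these are
  integers, the fine interval lies within the coarse one.\<close>

lemma grid_cube_nested:
  assumes l: "0 < l" and j: "j \<le> j'" and x: "x \<in> grid_cube n a l j k" "x \<in> grid_cube n a l j' k'"
  shows "grid_cube n a l j' k' \<subseteq> grid_cube n a l j k"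
proof
  fix y assume y: "y \<in> grid_cube n a l j' k'"
  define h where "h = l / 2 ^ j'"
  define d :: nat where "d = 2 ^ (j' - j)"
  have h: "0 < h" "l / 2 ^ j = real d * h"
  proof -
    have "real d = 2 ^ (j' - j)" by (simp add: d_def)
    then show "0 < h" "l / 2 ^ j = real d * h"
      using l j by (auto simp: h_def power_diff)
  qed
  have "a i + real (k i) * (l / 2 ^ j) < y i \<and> y i < a i + real (k i + 1) * (l / 2 ^ j)" if i: "i < n" for i
  proof -
    have 1: "a i + real (k i) * (real d * h) < x i" "x i < a i + real (k i + 1) * (real d * h)"
      using x(1) i by (auto simp: mem_grid_cube h(2))
    have 2: "a i + real (k' i) * h < x i" "x i < a i + real (k' i + 1) * h"
      using x(2) i by (auto simp: mem_grid_cube h_def)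
    have 3: "a i + real (k' i) * h < y i" "y i < a i + real (k' i + 1) * h"
      using y i by (auto simp: mem_grid_cube h_def)
    have "real (k i * d) * h < real (k' i + 1) * h" using 1 2 unfolding of_nat_mult mult.assoc by linarith
    then have "k i * d < k' i + 1" using h by (simp only: mult_less_cancel_right_pos of_nat_less_iff)
    then have "real (k i * d) * h \<le> real (k' i) * h"
      using h by (intro mult_right_mono of_nat_mono) linarith+
    moreover have "real (k' i) * h < real ((k i + 1) * d) * h" using 1 2 unfolding of_nat_mult mult.assoc by linarith
    then have "k' i < (k i + 1) * d" using h by (simp only: mult_less_cancel_right_pos of_nat_less_iff)
    then have "real (k' i + 1) * h \<le> real ((k i + 1) * d) * h"
      using h by (intro mult_right_mono of_nat_mono) linarith+
    ultimately show ?thesis using 3 unfolding h(2) of_nat_mult mult.assoc by linarith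
  qed
  with y show "y \<in> grid_cube n a l j k" by (auto simp: mem_grid_cube)
qed

lemma grid_cube_sets [measurable]: "grid_cube n a l j k \<in> sets (leb n)"
  by (simp add: grid_cube_def)

lemma emeasure_grid_cube: "0 < l \<Longrightarrow> emeasure (leb n) (grid_cube n a l j k) = ennreal ((l / 2 ^ j) ^ n)"
  by (simp add: grid_cube_def emeasure_open_cube)

lemma grid_cube_0: "grid_cube n a l 0 (\<lambda>_. 0) = open_cube n a l"
  by (simp add: grid_cube_def)

lemma finite_grid_gen: "finite {grid_cube n a l j k | k. \<forall>i<n. k i < 2 ^ j}"
proof (rule finite_subset)
  show "{grid_cube n a l j k | k. \<forall>i<n. k i < 2 ^ j} \<subseteq>
      grid_cube n a l j ` (\<Pi>\<^sub>E i\<in>{..<n}. {..<2 ^ j})"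
  proof
    fix Q assume "Q \<in> {grid_cube n a l j k | k. \<forall>i<n. k i < 2 ^ j}"
    then obtain k where k: "Q = grid_cube n a l j k" "\<forall>i<n. k i < 2 ^ j" by auto
    then have "Q = grid_cube n a l j (restrict k {..<n})"
      unfolding k(1) grid_cube_def by (intro open_cube_cong) auto
    then show "Q \<in> grid_cube n a l j ` (\<Pi>\<^sub>E i\<in>{..<n}. {..<2 ^ j})" using k by auto
  qed
qed (auto intro: finite_PiE)

lemma grid_Union: "grid n a l = (\<Union>j. {grid_cube n a l j k | k. \<forall>i<n. k i < 2 ^ j})"
  by (auto simp: grid_def)

lemma countable_grid: "countable (grid n a l)"
  unfolding grid_Union by (intro countable_UN countable_finite[OF finite_grid_gen]) simp

lemma grid_cube_subset:
  assumes "0 < l" "\<forall>i<n. k i < 2 ^ j"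
  shows "grid_cube n a l j k \<subseteq> open_cube n a l"
proof
  fix x assume x: "x \<in> grid_cube n a l j k"
  have "a i < x i \<and> x i < a i + l" if i: "i < n" for i
  proof -
    have "k i + 1 \<le> 2 ^ j" using assms i by (simp add: Suc_le_eq)
    then have "real (k i + 1) \<le> real (2 ^ j)" by (rule of_nat_mono)
    then have "real (k i + 1) * (l / 2 ^ j) \<le> real (2 ^ j) * (l / 2 ^ j)"
      using assms by (intro mult_right_mono) auto
    then have "real (k i + 1) * (l / 2 ^ j) \<le> l" by simp
    moreover have "0 \<le> real (k i) * (l / 2 ^ j)" using assms by auto
    ultimately show ?thesis using x i by (force simp: mem_grid_cube)
  qed
  with x show "x \<in> open_cube n a l" by (auto simp: mem_grid_cube open_cube_def PiE_iff)
qed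

text \<open>Volumes decide: a cube of a later generation is too small to contain one of an earlier
  generation. Hence a grid cube has supersets in finitely many generations only.\<close>

lemma grid_cube_subset_imp_le:
  assumes "1 \<le> n" "0 < l" "grid_cube n a l j k \<subseteq> grid_cube n a l j' k'"
  shows "j' \<le> j"
proof (rule ccontr)
  assume "\<not> j' \<le> j"
  then have "(2::real) ^ j < 2 ^ j'" by simp
  then have less: "l / 2 ^ j' < l / 2 ^ j" using assms by (intro divide_strict_left_mono) auto
  have "emeasure (leb n) (grid_cube n a l j k) \<le> emeasure (leb n) (grid_cube n a l j' k')"
    by (intro emeasure_mono assms) auto
  then show False using assms less by (auto simp: emeasure_grid_cube)
qed

lemma hyperplane_null:
  assumes "i < n"
  shows "{x \<in> space (leb n). x i = c} \<in> null_sets (leb n)"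
proof -
  define A where "A j = (if j = i then {c} else UNIV :: real set)" for j
  have A: "A j \<in> sets borel" for j by (simp add: A_def)
  have "x i = c \<longleftrightarrow> (\<forall>j\<in>{..<n}. x j \<in> A j)" for x
    using assms by (auto simp: A_def)
  then have eq: "{x \<in> space (leb n). x i = c} = Pi\<^sub>E {..<n} A"
    by (auto simp: space_PiM PiE_iff extensional_def)
  have "(\<Prod>j<n. emeasure lborel (A j)) = 0"
    by (rule prod_zero) (use assms in \<open>auto simp: A_def intro: bexI[of _ i]\<close>)
  then have "emeasure (leb n) (Pi\<^sub>E {..<n} A) = 0"
    using emeasure_PiE_leb[OF A] by simp
  then show ?thesis unfolding eq using sets_PiE_leb[OF A] by (intro null_setsI)
qed

text \<open>The points missed by the open cubes of some generation lie on countably many coordinate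
  hyperplanes, each of them null.\<close>

lemma AE_grid_cube:
  assumes l: "0 < l"
  shows "AE x in leb n. x \<in> open_cube n a l \<longrightarrow> (\<forall>j. \<exists>k. (\<forall>i<n. k i < 2 ^ j) \<and> x \<in> grid_cube n a l j k)"
proof -
  have "AE x in leb n. \<forall>i\<in>{..<n}. \<forall>j k. x i \<noteq> a i + real k * (l / 2 ^ j)"
    by (intro AE_ball_countable[THEN iffD2] ballI countable_finite)
       (auto simp: AE_all_countable intro!: AE_I'[OF hyperplane_null])
  then show ?thesis
  proof (eventually_elim, intro impI allI)
    fix x j
    assume ne: "\<forall>i\<in>{..<n}. \<forall>j k. x i \<noteq> a i + real k * (l / 2 ^ j)" and x: "x \<in> open_cube n a l"
    define h where "h = l / 2 ^ j"
    have h: "0 < h" "l = h * 2 ^ j" using l by (auto simp: h_def)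
    \<comment> \<open>The floor selects the half-open cell containing \<open>x i\<close>; avoiding
      the hyperplanes makes the left inequality strict.\<close>
    define k where "k i = nat \<lfloor>(x i - a i) / h\<rfloor>" for i
    have "k i < 2 ^ j \<and> a i + real (k i) * h < x i \<and> x i < a i + real (k i + 1) * h" if i: "i < n" for i
    proof -
      have xi: "a i < x i" "x i < a i + l" using x i by (auto simp: open_cube_def PiE_iff)
      define y where "y = (x i - a i) / h"
      have y: "0 < y" "y < 2 ^ j" "x i = a i + y * h" using xi h by (auto simp: y_def field_simps)
      have k: "real (k i) = of_int \<lfloor>y\<rfloor>" using y unfolding k_def y_def[symmetric] by simp
      have le: "real (k i) \<le> y" unfolding k by (rule of_int_floor_le)
      then have "real (k i) < real (2 ^ j)" using y(2) unfolding of_nat_power of_nat_numeral by (rule le_less_trans)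
      then have lt: "k i < 2 ^ j" by (simp only: of_nat_less_iff)
      have "real (k i) \<noteq> y" using ne i y(3) unfolding h_def by auto
      with le have "real (k i) * h < y * h" using h by (intro mult_strict_right_mono) auto
      moreover have "y < real (k i + 1)" using k by linarith
      then have "y * h < real (k i + 1) * h" using h by (intro mult_strict_right_mono) auto
      ultimately show ?thesis using lt y(3) by linarith
    qed
    then show "\<exists>k. (\<forall>i<n. k i < 2 ^ j) \<and> x \<in> grid_cube n a l j k"
      using x by (intro exI[of _ k]) (auto simp: mem_grid_cube h_def open_cube_def PiE_iff)
  qed
qed

section \<open>The open cube as a laminar space\<close>

abbreviation cube_measure :: "nat \<Rightarrow> (nat \<Rightarrow> real) \<Rightarrow> real \<Rightarrow> (nat \<Rightarrow> real) measure" where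
  "cube_measure n a l \<equiv> restrict_space (leb n) (open_cube n a l)"

lemma cube_measure_sets:
  "Z \<in> sets (cube_measure n a l) \<longleftrightarrow> Z \<in> sets (leb n) \<and> Z \<subseteq> open_cube n a l"
  using sets_restrict_space_iff[of "open_cube n a l" "leb n" Z] sets.sets_into_space[of "open_cube n a l" "leb n"]
  by (auto simp: Int_absorb2)

lemma measure_cube_measure:
  "Z \<subseteq> open_cube n a l \<Longrightarrow> measure (cube_measure n a l) Z = measure (leb n) Z"
  using sets.sets_into_space[of "open_cube n a l" "leb n"]
  by (intro measure_restrict_space) (auto simp: Int_absorb2)

lemma emeasure_cube_measure:
  "Z \<subseteq> open_cube n a l \<Longrightarrow> emeasure (cube_measure n a l) Z = emeasure (leb n) Z"
  using sets.sets_into_space[of "open_cube n a l" "leb n"]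
  by (intro emeasure_restrict_space) (auto simp: Int_absorb2)

lemma space_cube_measure [simp]: "space (cube_measure n a l) = open_cube n a l"
  using sets.sets_into_space[of "open_cube n a l" "leb n"] by (auto simp: space_restrict_space)

lemma gridE:
  assumes "Q \<in> grid n a l"
  obtains j k where "Q = grid_cube n a l j k" "\<forall>i<n. k i < 2 ^ j"
  using assms by (auto simp: grid_def)

lemma grid_subset: "0 < l \<Longrightarrow> Q \<in> grid n a l \<Longrightarrow> Q \<subseteq> open_cube n a l"
  by (metis gridE grid_cube_subset)

lemma open_cube_in_grid: "open_cube n a l \<in> grid n a l"
  unfolding grid_def using grid_cube_0[of n a l] by (auto intro!: exI[of _ 0] exI[of _ "\<lambda>_. 0"])

lemma measure_grid_cube:
  assumes "0 < l" "\<forall>i<n. k i < 2 ^ j"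
  shows "measure (cube_measure n a l) (grid_cube n a l j k) = (l / 2 ^ j) ^ n"
  using assms by (subst measure_cube_measure[OF grid_cube_subset]) (auto simp: measure_def emeasure_grid_cube)

lemma laminar_space_grid:
  assumes n: "1 \<le> n" and l: "0 < l"
  shows "laminar_space (cube_measure n a l) (grid n a l)"
proof (intro laminar_space.intro laminar_space_axioms.intro)
  show "finite_measure (cube_measure n a l)"
    using l by (intro finite_measureI) (simp add: emeasure_cube_measure emeasure_open_cube)
next
  fix Q R assume Q: "Q \<in> grid n a l" and R: "R \<in> grid n a l"
  obtain j k j' k' where *: "Q = grid_cube n a l j k" "R = grid_cube n a l j' k'"
    using Q R by (metis gridE)
  show "Q \<subseteq> R \<or> R \<subseteq> Q \<or> Q \<inter> R = {}"
  proof (cases "Q \<inter> R = {}")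
    case False
    then obtain x where "x \<in> Q" "x \<in> R" by auto
    then show ?thesis
      using grid_cube_nested[OF l, of j j' x n a k k'] grid_cube_nested[OF l, of j' j x n a k' k] *
      by (cases "j \<le> j'") auto
  qed auto
next
  fix Q assume Q: "Q \<in> grid n a l"
  then obtain j k where Qjk: "Q = grid_cube n a l j k" "\<forall>i<n. k i < 2 ^ j" by (rule gridE)
  show "Q \<in> sets (cube_measure n a l)"
    using grid_subset[OF l Q] Qjk by (simp add: cube_measure_sets)
  show "0 < measure (cube_measure n a l) Q"
    using Qjk l by (simp add: measure_grid_cube)
  show "finite {R \<in> grid n a l. Q \<subseteq> R}"
  proof (rule finite_subset)
    show "finite (\<Union>i\<in>{..j}. {grid_cube n a l i k | k. \<forall>m<n. k m < 2 ^ i})"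
      by (intro finite_UN_I finite_grid_gen) auto
    show "{R \<in> grid n a l. Q \<subseteq> R} \<subseteq> (\<Union>i\<in>{..j}. {grid_cube n a l i k | k. \<forall>m<n. k m < 2 ^ i})"
    proof
      fix R assume R: "R \<in> {R \<in> grid n a l. Q \<subseteq> R}"
      then obtain j' k' where R': "R = grid_cube n a l j' k'" "\<forall>i<n. k' i < 2 ^ j'" by (auto elim: gridE)
      have "j' \<le> j" by (rule grid_cube_subset_imp_le[OF n l]) (use R R' Qjk in auto)
      with R' show "R \<in> (\<Union>i\<in>{..j}. {grid_cube n a l i k | k. \<forall>m<n. k m < 2 ^ i})" by blast
    qed
  qed
qed (auto simp: countable_grid open_cube_in_grid)

lemma grid_parent:
  assumes n: "1 \<le> n" and l: "0 < l" and Q: "Q \<in> grid n a l" "Q \<noteq> open_cube n a l"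
  shows "\<exists>P\<in>grid n a l. Q \<subset> P \<and>
    measure (cube_measure n a l) P \<le> 2 ^ n * measure (cube_measure n a l) Q"
proof -
  obtain j k where Qjk: "Q = grid_cube n a l j k" "\<forall>i<n. k i < 2 ^ j" using Q(1) by (rule gridE)
  have "j \<noteq> 0"
  proof
    assume "j = 0"
    then have "Q = grid_cube n a l 0 (\<lambda>_. 0)"
      using Qjk unfolding grid_cube_def Qjk(1) by (auto intro!: open_cube_cong)
    with Q(2) show False by (simp add: grid_cube_0)
  qed
  then obtain i where j: "j = Suc i" by (cases j) auto
  \<comment> \<open>Halving the indices gives the parent: its side is \<open>2 * h\<close>, so its
    measure is \<open>2 ^ n\<close> times that of \<open>Q\<close>, and \<open>1 \<le> n\<close>
    makes the inclusion proper.\<close>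
  define P where "P = grid_cube n a l i (\<lambda>m. k m div 2)"
  define h where "h = l / 2 ^ j"
  have h: "0 < h" "l / 2 ^ i = 2 * h" using l by (auto simp: h_def j)
  have km: "\<forall>m<n. k m div 2 < 2 ^ i" using Qjk(2) by (auto simp: j)
  have "Q \<subseteq> P"
  proof
    fix x assume x: "x \<in> Q"
    have "a m + real (k m div 2) * (2 * h) < x m \<and> x m < a m + real (k m div 2 + 1) * (2 * h)" if m: "m < n" for m
    proof -
      have 1: "a m + real (k m) * h < x m" "x m < a m + real (k m + 1) * h"
        using x m by (auto simp: Qjk(1) mem_grid_cube h_def)
      have "real (2 * (k m div 2)) * h \<le> real (k m) * h"
        using h by (intro mult_right_mono of_nat_mono) auto
      moreover have "real (k m + 1) * h \<le> real (2 * (k m div 2 + 1)) * h"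
        using h by (intro mult_right_mono of_nat_mono) auto
      moreover have "real (2 * d) * h = real d * (2 * h)" for d :: nat by simp
      ultimately show ?thesis using 1 by (metis order_le_less_trans order_less_le_trans add_left_mono)
    qed
    with x show "x \<in> P" unfolding P_def Qjk(1) by (simp add: mem_grid_cube h(2) del: of_nat_add)
  qed
  moreover have mP: "measure (cube_measure n a l) P = 2 ^ n * h ^ n"
    unfolding P_def using measure_grid_cube[OF l km] h(2) by (simp add: power_mult_distrib)
  moreover have mQ: "measure (cube_measure n a l) Q = h ^ n"
    unfolding Qjk(1) h_def by (rule measure_grid_cube[OF l Qjk(2)])
  moreover have "(1::real) < 2 ^ n" using n by (intro one_less_power) auto
  then have "P \<noteq> Q" using mP mQ h(1) by auto
  moreover have "P \<in> grid n a l" using km unfolding P_def grid_def by blast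
  ultimately show ?thesis by auto
qed

section \<open>Outer regularity and density of the grid\<close>

lemma measurable_PiM_borel: "(\<lambda>x. x) \<in> measurable (Pi\<^sub>M {..<n} (\<lambda>_. lborel :: real measure)) (borel :: (nat \<Rightarrow> real) measure)"
proof -
  let ?P = "Pi\<^sub>M {..<n} (\<lambda>_. lborel :: real measure)"
  have "(\<lambda>x i. x i) \<in> measurable ?P (Pi\<^sub>M UNIV (\<lambda>_. borel))"
  proof (rule measurable_PiM_single')
    fix i :: nat
    show "(\<lambda>x. x i) \<in> measurable ?P borel"
    proof (cases "i < n")
      \<comment> \<open>Points of n-dimensional space sit among all sequences with the constant
        value \<open>undefined\<close> in the coordinates from \<open>n\<close> on.\<close>
      case False
      then have "x i = undefined" if "x \<in> space ?P" for x
        using that by (auto simp: space_PiM PiE_iff extensional_def)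
      then show ?thesis by (subst measurable_cong[where g = "\<lambda>_. undefined"]) auto
    qed (use measurable_component_singleton[of i "{..<n}" "\<lambda>_. lborel"] in simp)
  qed auto
  then show ?thesis using measurable_cong_sets[OF refl sets_PiM_equal_borel] by auto
qed

lemma open_cube_sets_PiM: "open_cube n a l \<in> sets (Pi\<^sub>M {..<n} (\<lambda>_. lborel))"
  unfolding open_cube_def by (auto intro: sets_PiM_I_finite)

text \<open>The library has outer regularity only for finite Borel measures on Polish type classes, so the
  product measure on the cube is transported to the type of all real sequences.\<close>

lemma open_superset:
  assumes l: "0 < l" and Z: "Z \<in> sets (leb n)" "Z \<subseteq> open_cube n a l" "0 < emeasure (leb n) Z"
  obtains B U where "B \<in> sets (leb n)" "B \<subseteq> Z" "emeasure (leb n) B = emeasure (leb n) Z"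
    "open U" "B \<subseteq> U" "U \<inter> open_cube n a l \<in> sets (leb n)"
    "emeasure (leb n) (U \<inter> open_cube n a l) < 2 * emeasure (leb n) Z"
proof -
  let ?P = "Pi\<^sub>M {..<n} (\<lambda>_. lborel :: real measure)"
  let ?X = "open_cube n a l"
  have X: "?X \<in> sets ?P" by (rule open_cube_sets_PiM)
  have XP: "?X \<inter> space ?P = ?X" using sets.sets_into_space[OF X] by auto
  \<comment> \<open>A set measurable for the completion contains a set of the uncompleted product
    algebra with the same measure.\<close>
  define B where "B = main_part ?P Z"
  have B: "B \<in> sets ?P" "emeasure (leb n) Z = emeasure ?P B"
    using Z(1) by (auto simp: B_def emeasure_completion main_part_sets)
  have BZ: "B \<subseteq> Z" using main_part_null_part_Un[OF Z(1)] by (auto simp: B_def)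
  have finP: "emeasure ?P ?X < \<infinity>"
    using emeasure_open_cube[OF l, of n a] X by (simp add: emeasure_completion)
  define \<nu> where "\<nu> = distr (restrict_space ?P ?X) borel (\<lambda>x. x)"
  have meas: "(\<lambda>x. x) \<in> measurable (restrict_space ?P ?X) borel"
    by (intro measurable_restrict_space1 measurable_PiM_borel)
  have \<nu>: "emeasure \<nu> W = emeasure ?P (W \<inter> ?X)" if "W \<in> sets borel" for W
    using that X XP unfolding \<nu>_def
    by (subst emeasure_distr[OF meas]) (auto simp: emeasure_restrict_space space_restrict_space)
  have WP: "W \<inter> ?X \<in> sets ?P" if "W \<in> sets borel" for W
  proof -
    have "W \<inter> space ?P \<in> sets ?P" using measurable_sets[OF measurable_PiM_borel that, of n] by simp
    then have "(W \<inter> space ?P) \<inter> ?X \<in> sets ?P" using X by auto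
    moreover have "(W \<inter> space ?P) \<inter> ?X = W \<inter> ?X" using XP by auto
    ultimately show ?thesis by simp
  qed
  \<comment> \<open>The cylinder over \<open>B\<close> is Borel in the space of sequences, being a
    preimage under restriction, and it meets the cube exactly in \<open>B\<close>.\<close>
  define B' where "B' = (\<lambda>x. restrict x {..<n}) -` B"
  have "(\<lambda>x. restrict x {..<n}) \<in> measurable (Pi\<^sub>M UNIV (\<lambda>_. borel)) ?P"
    by (auto intro!: measurable_restrict)
  then have "(\<lambda>x. restrict x {..<n}) \<in> measurable (borel :: (nat \<Rightarrow> real) measure) ?P"
    using measurable_cong_sets[OF sets_PiM_equal_borel refl] by auto
  from measurable_sets[OF this B(1)] have B': "B' \<in> sets borel" by (simp add: B'_def)
  have B'B: "B' \<inter> ?X = B"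
    using BZ Z(2) unfolding B'_def open_cube_def by (auto simp: PiE_restrict subset_iff)
  have "emeasure \<nu> B' = (INF U \<in> {U. B' \<subseteq> U \<and> open U}. emeasure \<nu> U)"
  proof (rule outer_regular)
    show "sets \<nu> = sets borel" by (simp add: \<nu>_def)
    show "emeasure \<nu> (space \<nu>) \<noteq> \<infinity>" using finP by (simp add: \<nu> [unfolded \<nu>_def] \<nu>_def)
  qed (use B' in simp)
  moreover have "emeasure \<nu> B' = emeasure (leb n) Z" using B' B B'B by (simp add: \<nu>)
  moreover have "emeasure (leb n) Z < 2 * emeasure (leb n) Z"
  proof -
    have "emeasure (leb n) Z \<le> emeasure (leb n) ?X" using Z by (intro emeasure_mono) auto
    also have "\<dots> < \<infinity>" using emeasure_open_cube[OF l] by simp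
    finally show ?thesis using Z(3)
      by (cases "emeasure (leb n) Z") (auto simp: ennreal_less_iff ennreal_mult'[symmetric] simp flip: ennreal_numeral)
  qed
  ultimately obtain U where U: "B' \<subseteq> U" "open U" "emeasure \<nu> U < 2 * emeasure (leb n) Z"
    by (auto simp: INF_less_iff)
  show thesis
  proof (rule that[of B U])
    show "U \<inter> ?X \<in> sets (leb n)" using WP[of U] U(2) by (auto intro: sets_completionI_sets)
    show "emeasure (leb n) (U \<inter> ?X) < 2 * emeasure (leb n) Z"
      using U WP[of U] by (simp add: \<nu> emeasure_completion)
    show "emeasure (leb n) B = emeasure (leb n) Z" using B by (simp add: emeasure_completion)
    show "B \<subseteq> U" using U(1) B'B by auto
  qed (use B BZ U in \<open>auto intro: sets_completionI_sets\<close>)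
qed

text \<open>Here \<open>U\<close> is open in the space of all sequences. Two points of a grid cube
  agree in every coordinate from \<open>n\<close> on, so a basic neighbourhood constrains only
  \<open>n\<close> coordinates and one generation \<open>j\<close> is fine enough for all of
  them.\<close>

lemma grid_cube_in_open:
  assumes l: "0 < l" and U: "open U" "x \<in> U"
  obtains j where "\<And>k. x \<in> grid_cube n a l j k \<Longrightarrow> grid_cube n a l j k \<subseteq> U"
proof -
  have "openin (product_topology (\<lambda>_. euclidean) UNIV) U" using U(1) unfolding open_fun_def .
  from bspec[OF iffD1[OF openin_product_topology_alt this] U(2)]
  obtain V where V: "\<forall>i\<in>UNIV. openin euclidean (V i)" "x \<in> Pi\<^sub>E UNIV V" "Pi\<^sub>E UNIV V \<subseteq> U"
    by (elim exE conjE) metis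
  have ev: "eventually (\<lambda>j. \<forall>i\<in>{..<n}. \<forall>y. \<bar>y - x i\<bar> < l / 2 ^ j \<longrightarrow> y \<in> V i) sequentially"
  proof (rule eventually_ball_finite, simp, rule ballI)
    fix i
    have "open (V i)" using V(1) by (simp add: open_openin[symmetric])
    moreover have "x i \<in> V i" using V(2) by (auto simp: PiE_iff)
    ultimately obtain e where e: "0 < e" "\<And>y. \<bar>y - x i\<bar> < e \<Longrightarrow> y \<in> V i"
      unfolding open_dist by (metis dist_real_def)
    have "(\<lambda>j. l * (1 / 2) ^ j) \<longlonglongrightarrow> l * 0"
      by (intro tendsto_intros LIMSEQ_power_zero) auto
    then have "eventually (\<lambda>j. l * (1 / 2) ^ j < e) sequentially"
      using e(1) by (auto dest: order_tendstoD(2))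
    then show "eventually (\<lambda>j. \<forall>y. \<bar>y - x i\<bar> < l / 2 ^ j \<longrightarrow> y \<in> V i) sequentially"
      by eventually_elim (use e(2) in \<open>auto simp: power_one_over\<close>)
  qed
  then obtain j where j: "\<And>i y. i < n \<Longrightarrow> \<bar>y - x i\<bar> < l / 2 ^ j \<Longrightarrow> y \<in> V i"
    by (auto simp: eventually_sequentially)
  show thesis
  proof (rule that[of j], rule subsetI)
    fix k y assume x: "x \<in> grid_cube n a l j k" and y: "y \<in> grid_cube n a l j k"
    have "y i \<in> V i" for i
    proof (cases "i < n")
      case True
      have "a i + real (k i) * (l / 2 ^ j) < x i" "x i < a i + (real (k i) * (l / 2 ^ j) + l / 2 ^ j)"
        "a i + real (k i) * (l / 2 ^ j) < y i" "y i < a i + (real (k i) * (l / 2 ^ j) + l / 2 ^ j)"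
        using x y True by (auto simp: mem_grid_cube distrib_right add_divide_distrib add.commute)
      then have "\<bar>y i - x i\<bar> < l / 2 ^ j" by linarith
      with j[OF True] show ?thesis by auto
    next
      case False
      then have "y i = x i" using x y by (auto simp: mem_grid_cube extensional_def)
      with V(2) show ?thesis by (auto simp: PiE_iff)
    qed
    then show "y \<in> U" using V(3) by (auto simp: PiE_iff)
  qed
qed

text \<open>Outer regularity gives an open set \<open>U\<close> of less than twice the measure of \<open>Z\<close>. If no cube in \<open>U\<close>
  were filled by \<open>Z\<close> to more than half, the maximal cubes in \<open>U\<close>, which cover \<open>Z\<close> almost everywhere,
  would give a contradiction.\<close>

lemma grid_density:
  assumes n: "1 \<le> n" and l: "0 < l"
    and Z: "Z \<in> sets (cube_measure n a l)" "0 < measure (cube_measure n a l) Z"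
  shows "\<exists>Q\<in>grid n a l. measure (cube_measure n a l) Q < 2 * measure (cube_measure n a l) (Z \<inter> Q)"
proof (rule ccontr)
  assume neg: "\<not> ?thesis"
  interpret laminar_space "cube_measure n a l" "grid n a l" by (rule laminar_space_grid[OF n l])
  let ?M = "cube_measure n a l" and ?X = "open_cube n a l"
  have Z': "Z \<in> sets (leb n)" "Z \<subseteq> ?X" using Z(1) by (auto simp: cube_measure_sets)
  moreover have "0 < emeasure (leb n) Z"
    using Z(2) Z'(2) by (simp add: measure_def enn2real_positive_iff emeasure_cube_measure)
  ultimately obtain B U where B: "B \<in> sets (leb n)" "B \<subseteq> Z" "emeasure (leb n) B = emeasure (leb n) Z"
    and U: "open U" "B \<subseteq> U" "U \<inter> ?X \<in> sets (leb n)" "emeasure (leb n) (U \<inter> ?X) < 2 * emeasure (leb n) Z"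
    by (rule open_superset[OF l])
  define F where "F = {Q \<in> grid n a l. Q \<subseteq> U}"
  have F: "F \<subseteq> grid n a l" by (auto simp: F_def)
  have UF: "\<Union>F \<in> sets ?M" by (rule Union_sets[OF F])
  have "AE x in leb n. x \<in> B \<longrightarrow> x \<in> Z \<inter> \<Union>F"
    using AE_grid_cube[OF l, of n a]
  proof eventually_elim
    fix x assume x: "x \<in> ?X \<longrightarrow> (\<forall>j. \<exists>k. (\<forall>i<n. k i < 2 ^ j) \<and> x \<in> grid_cube n a l j k)"
    show "x \<in> B \<longrightarrow> x \<in> Z \<inter> \<Union>F"
    proof
      assume xB: "x \<in> B"
      then obtain j where j: "\<And>k. x \<in> grid_cube n a l j k \<Longrightarrow> grid_cube n a l j k \<subseteq> U"
        using grid_cube_in_open[OF l U(1)] U(2) by (metis subsetD)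
      obtain k where "\<forall>i<n. k i < 2 ^ j" "x \<in> grid_cube n a l j k" using x xB B(2) Z' by blast
      then have "grid_cube n a l j k \<in> F" using j by (auto simp: F_def grid_def)
      with \<open>x \<in> grid_cube n a l j k\<close> xB B(2) show "x \<in> Z \<inter> \<Union>F" by auto
    qed
  qed
  then have "emeasure (leb n) B \<le> emeasure (leb n) (Z \<inter> \<Union>F)"
    by (rule emeasure_mono_AE) (use Z' UF in \<open>auto simp: cube_measure_sets\<close>)
  then have "emeasure ?M Z \<le> emeasure ?M (Z \<inter> \<Union>F)"
    using Z'(2) B(3) by (simp add: emeasure_cube_measure le_infI1)
  then have "measure ?M Z \<le> measure ?M (Z \<inter> \<Union>F)"
    by (simp add: emeasure_eq_measure)
  also have "\<dots> = measure ?M (Z \<inter> \<Union>(maximal F))" by (simp add: Union_maximal[OF F])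
  also have "\<dots> \<le> 1 / 2 * measure ?M (space ?M \<inter> \<Union>(maximal F))"
  proof (rule measure_le_disjoint)
    show "maximal F \<subseteq> grid n a l" using maximal_subset F by auto
    fix Q assume "Q \<in> maximal F"
    then have Q: "Q \<in> grid n a l" using maximal_subset F by auto
    then have "space ?M \<inter> Q = Q" using grid_subset[OF l] by auto
    with neg Q show "measure ?M (Z \<inter> Q) \<le> 1 / 2 * measure ?M (space ?M \<inter> Q)" by auto
  qed (use disjoint_maximal[OF F] Z in \<open>auto simp: cube_measure_sets\<close>)
  also have "measure ?M (space ?M \<inter> \<Union>(maximal F)) \<le> measure ?M (U \<inter> ?X)"
    by (rule finite_measure_mono) (use U(3) Union_maximal[OF F] in \<open>auto simp: F_def cube_measure_sets\<close>)
  finally have "2 * measure ?M Z \<le> measure ?M (U \<inter> ?X)" by simp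
  moreover have "emeasure ?M (U \<inter> ?X) < 2 * emeasure ?M Z"
    using U(4) Z' by (simp add: emeasure_cube_measure)
  then have "measure ?M (U \<inter> ?X) < 2 * measure ?M Z"
    by (simp add: emeasure_eq_measure ennreal_less_iff ennreal_mult'[symmetric] flip: ennreal_numeral)
  ultimately show False by simp
qed

lemma doubling_laminar_space_grid:
  assumes "1 \<le> n" "0 < l"
  shows "doubling_laminar_space (cube_measure n a l) (grid n a l) (2 ^ n)"
  using laminar_space_grid grid_parent grid_density assms
  by (intro doubling_laminar_space.intro doubling_laminar_space_axioms.intro) auto

section \<open>The weak type estimate on a cube\<close>

text \<open>Continuity from below along an enumeration of \<open>C\<close>. It allows the
  John-Nirenberg sums to be used for finite families only.\<close>

lemma emeasure_Union_le_sum: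
  assumes C: "countable C" "C \<subseteq> sets M"
    and le: "\<And>F. finite F \<Longrightarrow> F \<subseteq> C \<Longrightarrow> (\<Sum>Q\<in>F. emeasure M Q) \<le> T"
  shows "emeasure M (\<Union>C) \<le> T"
proof (cases "C = {}")
  case False
  define A where "A k = \<Union>(from_nat_into C ` {..k})" for k
  have c: "range (from_nat_into C) = C" by (rule range_from_nat_into[OF False C(1)])
  then have sub: "from_nat_into C ` {..k} \<subseteq> C" for k by blast
  have A: "A k \<in> sets M" for k
    unfolding A_def using sub[of k] C(2) by (intro sets.finite_Union) auto
  have "emeasure M (A k) \<le> T" for k
  proof -
    have "emeasure M (\<Union>Q\<in>from_nat_into C ` {..k}. Q) \<le> (\<Sum>Q\<in>from_nat_into C ` {..k}. emeasure M Q)"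
      by (rule emeasure_subadditive_finite) (use sub[of k] C(2) in auto)
    also have "\<dots> \<le> T" by (rule le) (use sub[of k] in auto)
    finally show ?thesis by (simp add: A_def)
  qed
  moreover have "incseq A" by (rule incseq_SucI) (auto simp: A_def atMost_Suc)
  then have "(SUP k. emeasure M (A k)) = emeasure M (\<Union>k. A k)"
    using A by (intro SUP_emeasure_incseq) auto
  moreover have "(\<Union>k. A k) = \<Union>C"
  proof
    show "(\<Union>k. A k) \<subseteq> \<Union>C" unfolding A_def using sub by blast
    show "\<Union>C \<subseteq> (\<Union>k. A k)"
    proof
      fix x assume "x \<in> \<Union>C"
      then obtain Q where "Q \<in> C" "x \<in> Q" by blast
      moreover from this c have "Q \<in> range (from_nat_into C)" by simp
      ultimately obtain i where "x \<in> from_nat_into C i" by blast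
      then have "x \<in> A i" by (auto simp: A_def)
      then show "x \<in> (\<Union>k. A k)" by blast
    qed
  qed
  ultimately show ?thesis by (metis SUP_least)
qed simp

section \<open>Powers in \<open>ennreal\<close> and suprema over dyadic families\<close>

lemma epowr_ennreal [simp]: "0 \<le> x \<Longrightarrow> epowr (ennreal x) p = ennreal (x powr p)"
  by (simp add: epowr_def)

lemma epowr_top [simp]: "epowr top p = top"
  by (simp add: epowr_def)

lemma epowr_mono: "x \<le> y \<Longrightarrow> 0 \<le> p \<Longrightarrow> epowr x p \<le> epowr y p"
  by (cases x; cases y) (auto simp: powr_mono2 top_unique)

lemma epowr_epowr: "0 < p \<Longrightarrow> epowr (epowr x (1 / p)) p = x"
  by (cases x) (auto simp: powr_powr)

text \<open>The common shape of the p-th powers of both norms. What matters is its dependence on the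
  cube: it is superadditive over dyadic subcubes with disjoint interiors.\<close>

definition family_sup ::
    "nat \<Rightarrow> ((nat \<Rightarrow> real) set \<Rightarrow> ennreal) \<Rightarrow> (nat \<Rightarrow> real) set \<Rightarrow> ennreal" where
  "family_sup n g Q0 = (SUP C \<in> dyadic_families n Q0. \<Sum>\<^sub>\<infinity>Q\<in>C. g Q)"

abbreviation almost_disjoint :: "nat \<Rightarrow> (nat \<Rightarrow> real) set set \<Rightarrow> bool" where
  "almost_disjoint n \<equiv> pairwise (\<lambda>Q R. disjnt (Rtop n interior_of Q) (Rtop n interior_of R))"

lemma sum_le_family_sup:
  assumes "finite F" "F \<subseteq> dyadic n Q0" "almost_disjoint n F"
  shows "sum g F \<le> family_sup n g Q0"
  unfolding family_sup_def
  by (rule SUP_upper2[of F]) (use assms in \<open>auto simp: dyadic_families_def countable_finite\<close>)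

text \<open>In \<open>ennreal\<close> an infinite sum is the supremum of its finite partial sums,
  and subfamilies of admissible families are admissible.\<close>

lemma family_sup_leI:
  assumes "\<And>F. finite F \<Longrightarrow> F \<subseteq> dyadic n Q0 \<Longrightarrow> almost_disjoint n F \<Longrightarrow> sum g F \<le> T"
  shows "family_sup n g Q0 \<le> T"
  unfolding family_sup_def
proof (rule SUP_least)
  fix C assume C: "C \<in> dyadic_families n Q0"
  have "infsum g C = (SUP F\<in>{F. finite F \<and> F \<subseteq> C}. sum g F)"
    by (rule nonneg_infsum_complete) auto
  also have "\<dots> \<le> T"
  proof (rule SUP_least)
    fix F assume "F \<in> {F. finite F \<and> F \<subseteq> C}"
    then show "sum g F \<le> T"
      using C by (intro assms) (auto simp: dyadic_families_def intro: pairwise_subset)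
  qed
  finally show "infsum g C \<le> T" .
qed

lemma JN_median_norm_eq:
  "JN_median_norm n p s Q0 f =
    epowr (family_sup n (\<lambda>Q. emeasure (leb n) Q * epowr (median_osc n s f Q) p) Q0) (1 / p)"
  by (simp add: JN_median_norm_def family_sup_def)

lemma JN_norm_eq:
  "f \<in> L1_on n Q0 \<Longrightarrow> JN_norm n p Q0 f =
    epowr (family_sup n (\<lambda>Q. emeasure (leb n) Q * epowr (mean_osc n f Q) p) Q0) (1 / p)"
  by (simp add: JN_norm_def family_sup_def)

lemma cube_in_dyadic:
  assumes "1 \<le> n" "0 < l"
  shows "cube n a l \<in> dyadic n (cube n a l)"
  unfolding dyadic_cube_eq[OF assms] by (auto intro!: exI[of _ 0] exI[of _ "\<lambda>_. 0"])

lemma dyadic_subcube: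
  assumes n: "1 \<le> n" and l: "0 < l" and Q: "Q \<in> dyadic n (cube n a l)"
  obtains b l' where "0 < l'" "Q = cube n b l'" "Q \<subseteq> cube n a l"
    "dyadic n Q \<subseteq> dyadic n (cube n a l)"
proof -
  obtain j k where Qjk: "Q = cube n (\<lambda>i. a i + real (k i) * (l / 2 ^ j)) (l / 2 ^ j)" "\<forall>i<n. k i < 2 ^ j"
    using Q unfolding dyadic_cube_eq[OF n l] by auto
  let ?b = "\<lambda>i. a i + real (k i) * (l / 2 ^ j)" and ?l = "l / 2 ^ j"
  have l': "0 < ?l" using l by simp
  have "Q \<subseteq> cube n a l"
    unfolding Qjk(1) cube_def
  proof (rule PiE_mono)
    fix i assume i: "i \<in> {..<n}"
    have "k i + 1 \<le> 2 ^ j" using Qjk(2) i by (simp add: Suc_le_eq)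
    then have "real (k i + 1) \<le> real (2 ^ j)" by (rule of_nat_mono)
    then have "real (k i + 1) * ?l \<le> real (2 ^ j) * ?l" using l by (intro mult_right_mono) auto
    then have "real (k i) * ?l + ?l \<le> l" by (simp add: distrib_right add_divide_distrib)
    moreover have "0 \<le> real (k i) * ?l" using l by simp
    ultimately show "{?b i .. ?b i + ?l} \<subseteq> {a i .. a i + l}" by auto
  qed
  moreover have "dyadic n Q \<subseteq> dyadic n (cube n a l)"
  proof
    fix R assume "R \<in> dyadic n Q"
    then obtain j' k' where R: "R = cube n (\<lambda>i. ?b i + real (k' i) * (?l / 2 ^ j')) (?l / 2 ^ j')"
        "\<forall>i<n. k' i < 2 ^ j'"
      unfolding Qjk(1) dyadic_cube_eq[OF n l'] by auto
    have l2: "?l / 2 ^ j' = l / 2 ^ (j + j')" by (simp add: power_add)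
    \<comment> \<open>A subcube of generation \<open>j'\<close> in a cube of generation
      \<open>j\<close> has generation \<open>j + j'\<close>, and its index is shifted by
      \<open>2 ^ j'\<close> for each step of the outer index.\<close>
    have "?b i + real (k' i) * (l / 2 ^ (j + j')) = a i + real (k i * 2 ^ j' + k' i) * (l / 2 ^ (j + j'))" for i
      by (simp add: power_add field_simps)
    then have "R = cube n (\<lambda>i. a i + real (k i * 2 ^ j' + k' i) * (l / 2 ^ (j + j'))) (l / 2 ^ (j + j'))"
      unfolding R(1) l2 by (intro cube_cong)
    moreover have "\<forall>i<n. k i * 2 ^ j' + k' i < 2 ^ (j + j')"
    proof (intro allI impI)
      fix i assume i: "i < n"
      have "k i * 2 ^ j' + k' i < (k i + 1) * 2 ^ j'" using R(2) i by simp
      also have "\<dots> \<le> 2 ^ j * 2 ^ j'" using Qjk(2) i by (intro mult_right_mono) (auto simp: Suc_le_eq)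
      finally show "k i * 2 ^ j' + k' i < 2 ^ (j + j')" by (simp add: power_add)
    qed
    ultimately show "R \<in> dyadic n (cube n a l)"
      unfolding dyadic_cube_eq[OF n l] mem_Collect_eq
      by (intro exI[of _ "j + j'"] exI[of _ "\<lambda>i. k i * 2 ^ j' + k' i"]) auto
  qed
  ultimately show thesis using l' Qjk(1) that by blast
qed

lemma emeasure_interior_cube:
  assumes "0 < l" "A \<in> sets (leb n)" "A \<subseteq> cube n a l"
  shows "emeasure (leb n) A = emeasure (leb n) (A \<inter> open_cube n a l)"
proof (rule emeasure_eq_AE)
  show "AE x in leb n. x \<in> A \<longleftrightarrow> x \<in> A \<inter> open_cube n a l"
    using AE_not_in[OF cube_diff_null[OF assms(1), of n a]] by eventually_elim (use assms(3) in auto)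
qed (use assms in auto)

section \<open>Measurability, medians and median oscillation\<close>

lemma meas_on_sets:
  assumes "Q \<in> sets (leb n)" and g: "g \<in> borel_measurable (restrict_space (leb n) Q)"
  shows "{x \<in> Q. g x > (t :: ereal)} \<in> sets (leb n)"
proof -
  have sp: "space (restrict_space (leb n) Q) = Q"
    using sets.sets_into_space[OF assms(1)] by (auto simp: space_restrict_space)
  have "{x \<in> space (restrict_space (leb n) Q). g x > t} \<in> sets (restrict_space (leb n) Q)"
    using g by measurable
  moreover have "Q \<inter> space (leb n) \<in> sets (leb n)" using assms(1) by blast
  ultimately show ?thesis unfolding sp by (simp only: sets_restrict_space_iff)
qed

lemma meas_on_dev_sets:
  assumes "Q \<in> sets (leb n)" "f \<in> meas_on n Q"
  shows "{x \<in> Q. \<bar>f x - ereal c\<bar> > ereal d} \<in> sets (leb n)"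
  using assms by (intro meas_on_sets) (auto simp: meas_on_def)

lemma meas_on_subset: "f \<in> meas_on n Q \<Longrightarrow> R \<subseteq> Q \<Longrightarrow> f \<in> meas_on n R"
  unfolding meas_on_def by (rule measurable_restrict_mono)

text \<open>Neither infimum need be attained. Being strictly below \<open>d\<close> still leaves a
  constant \<open>c\<close> and a level \<open>a\<close> below \<open>d\<close>, and raising the
  level to \<open>d\<close> only shrinks the exceptional set.\<close>

lemma median_osc_less:
  assumes Q: "Q \<in> sets (leb n)" and f: "f \<in> meas_on n Q" and less: "median_osc n s f Q < ennreal d"
  obtains c where "emeasure (leb n) {x \<in> Q. \<bar>f x - ereal c\<bar> > ereal d} < ennreal s * emeasure (leb n) Q"
proof -
  have "(INF c::real. max_median n s (\<lambda>x. \<bar>f x - ereal c\<bar>) Q) < ereal d"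
  proof (rule ccontr)
    assume "\<not> ?thesis"
    then have "e2ennreal (ereal d) \<le> median_osc n s f Q"
      unfolding median_osc_def by (intro e2ennreal_mono) simp
    with less show False by (simp add: ennreal.rep_eq ennreal_def[symmetric] flip: e2ennreal_ereal)
  qed
  then obtain c a where "ereal a < ereal d"
    "emeasure (leb n) {x \<in> Q. \<bar>f x - ereal c\<bar> > ereal a} < ennreal s * emeasure (leb n) Q"
    unfolding max_median_def by (auto simp: INF_less_iff Inf_less_iff)
  moreover have "emeasure (leb n) {x \<in> Q. \<bar>f x - ereal c\<bar> > ereal d} \<le>
      emeasure (leb n) {x \<in> Q. \<bar>f x - ereal c\<bar> > ereal a}" if "ereal a < ereal d"
    by (rule emeasure_mono)
       (use meas_on_dev_sets[OF Q f] in \<open>auto intro: less_trans[OF that]\<close>)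
  ultimately show thesis using that by (meson le_less_trans)
qed

text \<open>Above \<open>c + d\<close> there is less than an \<open>s\<close>-fraction of
  \<open>Q\<close>, hence less than an \<open>r\<close>-fraction. A level \<open>a < c - d\<close>
  admissible for the median would cover \<open>Q\<close> by two sets of measure below
  \<open>s\<close> and \<open>r\<close> times that of \<open>Q\<close>, which is impossible as
  \<open>s + r \<le> 1\<close>. Thus medians for all these \<open>r\<close> satisfy the hypothesis
  on \<open>m\<close> in \<open>weak_type\<close>.\<close>

lemma max_median_near:
  assumes Q: "Q \<in> sets (leb n)" "emeasure (leb n) Q < \<infinity>" and f: "f \<in> meas_on n Q"
    and r: "0 < s" "s \<le> r" "r \<le> 1 / 2"
    and c: "emeasure (leb n) {x \<in> Q. \<bar>f x - ereal c\<bar> > ereal d} < ennreal s * emeasure (leb n) Q"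
  shows "ereal (c - d) \<le> max_median n r f Q" "max_median n r f Q \<le> ereal (c + d)"
proof -
  let ?\<mu> = "emeasure (leb n)" and ?D = "{x \<in> Q. \<bar>f x - ereal c\<bar> > ereal d}"
  have D: "?D \<in> sets (leb n)" by (rule meas_on_dev_sets[OF Q(1) f])
  have sets: "{x \<in> Q. f x > ereal a} \<in> sets (leb n)" for a
    using f by (intro meas_on_sets[OF Q(1)]) (auto simp: meas_on_def)
  have "?\<mu> {x \<in> Q. f x > ereal (c + d)} \<le> ?\<mu> ?D"
  proof (rule emeasure_mono[OF _ D], safe)
    fix x assume "f x > ereal (c + d)"
    then show "\<bar>f x - ereal c\<bar> > ereal d" by (cases "f x") auto
  qed
  also note c
  also have "ennreal s * ?\<mu> Q \<le> ennreal r * ?\<mu> Q"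
    using r by (intro mult_right_mono ennreal_leI) auto
  finally show "max_median n r f Q \<le> ereal (c + d)"
    unfolding max_median_def by (intro Inf_lower) auto
  show "ereal (c - d) \<le> max_median n r f Q"
    unfolding max_median_def
  proof (intro Inf_greatest, safe)
    fix a assume a: "?\<mu> {x \<in> Q. f x > ereal a} < ennreal r * ?\<mu> Q"
    show "ereal (c - d) \<le> ereal a"
    proof (rule ccontr)
      assume "\<not> ereal (c - d) \<le> ereal a"
      then have ad: "a < c - d" by simp
      have "Q \<subseteq> ?D \<union> {x \<in> Q. f x > ereal a}"
      proof
        fix x assume "x \<in> Q"
        then show "x \<in> ?D \<union> {x \<in> Q. f x > ereal a}" using ad by (cases "f x") auto
      qed
      then have "?\<mu> Q \<le> ?\<mu> (?D \<union> {x \<in> Q. f x > ereal a})"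
        by (rule emeasure_mono) (use D sets in auto)
      also have "\<dots> \<le> ?\<mu> ?D + ?\<mu> {x \<in> Q. f x > ereal a}"
        by (rule emeasure_subadditive) (use D sets in auto)
      also have "\<dots> < ennreal s * ?\<mu> Q + ennreal r * ?\<mu> Q"
        using c a by (rule add_strict_mono)
      also have "\<dots> = ennreal (s + r) * ?\<mu> Q" using r by (simp add: distrib_right)
      also have "\<dots> \<le> ennreal 1 * ?\<mu> Q" using r by (intro mult_right_mono ennreal_leI) auto
      finally show False by simp
    qed
  qed
qed

definition weak_const :: "real \<Rightarrow> real" where
  "weak_const p = 4 * (2 / (2 powr (1 / p) - 1)) powr p"

proposition weak_type_cube:
  assumes n: "1 \<le> n" and l: "0 < l" and p: "1 < p" and s: "0 < s" "s \<le> 1 / 2 ^ (n + 3)"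
    and f: "f \<in> meas_on n (cube n a l)" and T: "0 \<le> T" and t: "0 < t"
    and S: "family_sup n (\<lambda>Q. emeasure (leb n) Q * epowr (median_osc n s f Q) p) (cube n a l) \<le> ennreal T"
    and m: "\<And>c d. emeasure (leb n) {x \<in> cube n a l. \<bar>f x - ereal c\<bar> > ereal d}
      < ennreal s * emeasure (leb n) (cube n a l) \<Longrightarrow> \<bar>c - m\<bar> \<le> d"
  shows "emeasure (leb n) {x \<in> cube n a l. \<bar>f x - ereal m\<bar> > ereal t} \<le> ennreal (weak_const p * T / t powr p)"
proof -
  let ?X = "open_cube n a l" and ?M = "cube_measure n a l"
  interpret doubling_laminar_space ?M "grid n a l" "2 ^ n"
    by (rule doubling_laminar_space_grid[OF n l])
  have fM: "f \<in> borel_measurable ?M"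
    using meas_on_subset[OF f open_cube_subset] by (simp add: meas_on_def)
  \<comment> \<open>The exponent \<open>n + 3\<close> splits into the doubling constant
    \<open>2 ^ n\<close> and the eighth that the good-lambda argument requires.\<close>
  have s': "0 < s" "s \<le> 1 / 8" "s * 2 ^ n \<le> 1 / 8"
  proof -
    show "s * 2 ^ n \<le> 1 / 8" using s(2) by (simp add: power_add field_simps)
    moreover have "s * 1 \<le> s * 2 ^ n" using s(1) by (intro mult_left_mono) auto
    ultimately show "s \<le> 1 / 8" by simp
  qed (fact s)
  have dev_closed: "emeasure (leb n) {x \<in> cube n a l. \<bar>f x - ereal c\<bar> > ereal d} = ennreal (measure ?M (dev f c d))" for c d
  proof -
    have "{x \<in> cube n a l. \<bar>f x - ereal c\<bar> > ereal d} \<inter> ?X = dev f c d"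
      using open_cube_subset by (auto simp: dev_def[OF fM s'])
    moreover have "dev f c d \<subseteq> ?X" by (auto simp: dev_def[OF fM s'])
    moreover have "emeasure (leb n) {x \<in> cube n a l. \<bar>f x - ereal c\<bar> > ereal d} =
        emeasure (leb n) ({x \<in> cube n a l. \<bar>f x - ereal c\<bar> > ereal d} \<inter> ?X)"
      by (rule emeasure_interior_cube[OF l meas_on_dev_sets[OF cube_sets f]]) auto
    ultimately show ?thesis
      by (simp add: emeasure_cube_measure[symmetric] emeasure_eq_measure)
  qed
  have "measure ?M (dev f m t) \<le> 4 * (2 / (2 powr (1 / p) - 1)) powr p * T / t powr p"
  proof (rule weak_type[OF fM s' p T t])
    fix c d assume "measure ?M (dev f c d) < s * measure ?M (space ?M)"
    then have "ennreal (measure ?M (dev f c d)) < ennreal (s * measure ?M (space ?M))"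
      by (simp add: ennreal_less_iff)
    also have "\<dots> = ennreal s * emeasure (leb n) (cube n a l)"
    proof -
      have "emeasure ?M (space ?M) = emeasure (leb n) (cube n a l)"
        using l emeasure_cube_measure[of ?X n a l] by (simp add: emeasure_cube emeasure_open_cube)
      then show ?thesis using s by (simp add: ennreal_mult emeasure_eq_measure)
    qed
    finally show "\<bar>c - m\<bar> \<le> d" by (intro m) (simp add: dev_closed)
  next
    fix C d
    assume C: "C \<subseteq> grid n a l" "disjoint C" and d: "(0::real) < d" and nt: "\<And>Q. Q \<in> C \<Longrightarrow> \<not> tight f s d Q"
    \<comment> \<open>The families of the laminar space consist of open cubes, the norm sums over
      closed ones. \<open>\<phi>\<close> selects the closed cube with a given interior; taking
      interiors inverts it, so it is injective.\<close>
    define \<phi> where "\<phi> = inv_into (dyadic n (cube n a l)) (\<lambda>Q. Rtop n interior_of Q)"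
    have \<phi>: "\<phi> Q \<in> dyadic n (cube n a l)" "Rtop n interior_of \<phi> Q = Q" if "Q \<in> C" for Q
    proof -
      have "Q \<in> (\<lambda>Q. Rtop n interior_of Q) ` dyadic n (cube n a l)"
        using that C(1) unfolding grid_eq_interior[OF n l] by blast
      then show "\<phi> Q \<in> dyadic n (cube n a l)" "Rtop n interior_of \<phi> Q = Q"
        unfolding \<phi>_def by (rule inv_into_into, rule f_inv_into_f)
    qed
    have osc: "ennreal d \<le> median_osc n s f (\<phi> Q) \<and> emeasure (leb n) (\<phi> Q) = emeasure (leb n) Q"
      if Q: "Q \<in> C" for Q
    proof -
      obtain b l' where b: "0 < l'" "\<phi> Q = cube n b l'" "\<phi> Q \<subseteq> cube n a l"
        "dyadic n (\<phi> Q) \<subseteq> dyadic n (cube n a l)"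
        by (rule dyadic_subcube[OF n l \<phi>(1)[OF Q]])
      then have Qb: "Q = open_cube n b l'" using \<phi>(2)[OF Q] interior_of_cube by metis
      have eq: "emeasure (leb n) (\<phi> Q) = emeasure (leb n) Q"
        by (simp only: b(2)) (simp add: Qb b(1) emeasure_cube emeasure_open_cube)
      have QX: "Q \<subseteq> ?X" using grid_subset[OF l] Q C(1) by auto
      have fQ: "f \<in> meas_on n (\<phi> Q)" by (rule meas_on_subset[OF f b(3)])
      have \<phi>s: "\<phi> Q \<in> sets (leb n)" by (simp add: b(2))
      have "\<not> median_osc n s f (\<phi> Q) < ennreal d"
      proof
        assume "median_osc n s f (\<phi> Q) < ennreal d"
        then obtain c where c: "emeasure (leb n) {x \<in> \<phi> Q. \<bar>f x - ereal c\<bar> > ereal d} < ennreal s * emeasure (leb n) (\<phi> Q)"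
          by (rule median_osc_less[OF \<phi>s fQ])
        have "emeasure (leb n) (dev f c d \<inter> Q) \<le> emeasure (leb n) {x \<in> \<phi> Q. \<bar>f x - ereal c\<bar> > ereal d}"
        proof (rule emeasure_mono)
          show "dev f c d \<inter> Q \<subseteq> {x \<in> \<phi> Q. \<bar>f x - ereal c\<bar> > ereal d}"
          proof -
            have "Q \<subseteq> \<phi> Q" using open_cube_subset[of n b l'] by (simp only: b(2) Qb[symmetric])
            then show ?thesis unfolding dev_def[OF fM s'] by auto
          qed
        qed (rule meas_on_dev_sets[OF \<phi>s fQ])
        also note c
        also note eq
        finally have "emeasure ?M (dev f c d \<inter> Q) < ennreal s * emeasure ?M Q"
          using QX by (simp add: emeasure_cube_measure le_infI2)
        then have "measure ?M (dev f c d \<inter> Q) < s * measure ?M Q"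
          using s by (simp add: emeasure_eq_measure ennreal_less_iff flip: ennreal_mult)
        then have "tight f s d Q" unfolding tight_def[OF fM s'] by blast
        with nt[OF Q] show False ..
      qed
      with eq show ?thesis by simp
    qed
    have "emeasure (leb n) (\<Union>C) \<le> ennreal (T / d powr p)"
    proof (rule emeasure_Union_le_sum)
      show "countable C" using C(1) countable_grid countable_subset by blast
      show "C \<subseteq> sets (leb n)" using C(1) D_sets by (auto simp: cube_measure_sets)
      fix F assume F: "finite F" "F \<subseteq> C"
      \<comment> \<open>Chebyshev's inequality for the John-Nirenberg sum: on every cube of
        \<open>F\<close> the median oscillation is at least \<open>d\<close>.\<close>
      have "ennreal (d powr p) * (\<Sum>Q\<in>F. emeasure (leb n) Q) =
          (\<Sum>Q\<in>F. emeasure (leb n) (\<phi> Q) * epowr (ennreal d) p)"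
        using osc F(2) d by (auto simp: sum_distrib_left mult.commute intro!: sum.cong)
      also have "\<dots> \<le> (\<Sum>Q\<in>F. emeasure (leb n) (\<phi> Q) * epowr (median_osc n s f (\<phi> Q)) p)"
        using osc F(2) p by (intro sum_mono mult_left_mono epowr_mono) auto
      also have "\<dots> = (\<Sum>Q\<in>\<phi> ` F. emeasure (leb n) Q * epowr (median_osc n s f Q) p)"
        by (subst sum.reindex) (use F(2) \<phi>(2) in \<open>auto intro!: inj_on_inverseI[of _ "\<lambda>Q. Rtop n interior_of Q"]\<close>)
      also have "\<dots> \<le> family_sup n (\<lambda>Q. emeasure (leb n) Q * epowr (median_osc n s f Q) p) (cube n a l)"
      proof (rule sum_le_family_sup)
        show "almost_disjoint n (\<phi> ` F)"
        proof (rule pairwiseI)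
          fix Q R assume "Q \<in> \<phi> ` F" "R \<in> \<phi> ` F" "Q \<noteq> R"
          then obtain Q' R' where "Q' \<in> F" "R' \<in> F" "Q' \<noteq> R'" "Q = \<phi> Q'" "R = \<phi> R'" by auto
          then show "disjnt (Rtop n interior_of Q) (Rtop n interior_of R)"
            using \<phi>(2) F(2) C(2) by (auto simp: disjoint_def disjnt_def subset_iff)
        qed
      qed (use F \<phi>(1) in auto)
      also have "\<dots> \<le> ennreal T" by (rule S)
      finally have le: "ennreal (d powr p) * (\<Sum>Q\<in>F. emeasure (leb n) Q) \<le> ennreal T" .
      show "(\<Sum>Q\<in>F. emeasure (leb n) Q) \<le> ennreal (T / d powr p)"
        using le d T by (cases "\<Sum>Q\<in>F. emeasure (leb n) Q")
          (auto simp: ennreal_mult_top top_unique field_simps simp flip: ennreal_mult)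
    qed
    moreover have "\<Union>C \<subseteq> ?X" using C(1) grid_subset[OF l] by blast
    ultimately have "emeasure ?M (\<Union>C) \<le> ennreal (T / d powr p)" by (simp add: emeasure_cube_measure)
    then show "measure ?M (\<Union>C) \<le> T / d powr p" using T by (simp add: emeasure_eq_measure)
  qed
  then show ?thesis unfolding dev_closed weak_const_def by (rule ennreal_leI)
qed

section \<open>Comparison of the two norms\<close>

lemma family_sup_eq:
  "family_sup n g Q0 = (SUP F \<in> {F. finite F \<and> F \<subseteq> dyadic n Q0 \<and> almost_disjoint n F}. sum g F)"
  by (intro antisym family_sup_leI SUP_least) (auto intro: sum_le_family_sup SUP_upper)

lemma family_sup_add_leI:
  assumes "\<And>F. finite F \<Longrightarrow> F \<subseteq> dyadic n Q0 \<Longrightarrow> almost_disjoint n F \<Longrightarrow> sum g F + x \<le> y"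
  shows "family_sup n g Q0 + x \<le> y"
proof -
  let ?I = "{F. finite F \<and> F \<subseteq> dyadic n Q0 \<and> almost_disjoint n F}"
  have "{} \<in> ?I" by (simp add: pairwise_def)
  then have "?I \<noteq> {}" by blast
  then have "family_sup n g Q0 + x = (SUP F \<in> ?I. sum g F + x)"
    unfolding family_sup_eq by (rule ennreal_SUP_add_left[symmetric])
  also have "\<dots> \<le> y" by (rule SUP_least) (use assms in auto)
  finally show ?thesis .
qed

text \<open>Consequently two families whose interiors are mutually disjoint have no cube in common,
  and their sums add up.\<close>

lemma interior_dyadic_nonempty:
  assumes "1 \<le> n" "0 < l" "Q \<in> dyadic n (cube n a l)"
  shows "Rtop n interior_of Q \<noteq> {}"
proof -
  obtain b l' where b: "0 < l'" "Q = cube n b l'" "Q \<subseteq> cube n a l" "dyadic n Q \<subseteq> dyadic n (cube n a l)"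
    by (rule dyadic_subcube[OF assms])
  then have "emeasure (leb n) (Rtop n interior_of Q) \<noteq> 0"
    by (simp add: interior_of_cube emeasure_open_cube)
  then show ?thesis by auto
qed

text \<open>Near-optimal families of the single cubes are joined one at a time; the family \<open>H\<close> in the proof
  collects the choices already made.\<close>

lemma sum_family_sup_le:
  assumes n: "1 \<le> n" and l: "0 < l"
    and F: "finite F" "F \<subseteq> dyadic n (cube n a l)" "almost_disjoint n F"
  shows "(\<Sum>Q\<in>F. family_sup n g Q) \<le> family_sup n g (cube n a l)"
proof -
  let ?int = "\<lambda>Q. Rtop n interior_of Q"
  have "(\<Sum>Q\<in>F. family_sup n g Q) + sum g H \<le> family_sup n g (cube n a l)"
    if "finite H" "H \<subseteq> dyadic n (cube n a l)" "almost_disjoint n H"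
      "\<And>Q R. Q \<in> F \<Longrightarrow> R \<in> H \<Longrightarrow> ?int Q \<inter> ?int R = {}" for H
    using F that
  proof (induction F arbitrary: H rule: finite_induct)
    case empty
    then show ?case by (simp add: sum_le_family_sup)
  next
    case (insert Q G)
    have Q: "Q \<in> dyadic n (cube n a l)" using insert.prems by auto
    obtain b l' where b: "0 < l'" "Q = cube n b l'" "Q \<subseteq> cube n a l" "dyadic n Q \<subseteq> dyadic n (cube n a l)"
      by (rule dyadic_subcube[OF n l Q])
    have GQ: "?int Q \<inter> ?int R = {}" if "R \<in> G" for R
      using that insert.prems(2) insert.hyps(2) by (auto simp: pairwise_insert disjnt_def)
    have "family_sup n g Q + ((\<Sum>Q\<in>G. family_sup n g Q) + sum g H) \<le> family_sup n g (cube n a l)"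
    proof (rule family_sup_add_leI)
      fix K assume K: "finite K" "K \<subseteq> dyadic n Q" "almost_disjoint n K"
      have intK: "?int R \<subseteq> ?int Q" if "R \<in> K" for R
      proof -
        have "R \<in> dyadic n (cube n b l')" using that K(2) b(2) by auto
        from dyadic_subcube[OF n b(1) this] have "R \<subseteq> Q" using b(2) by metis
        then show ?thesis by (rule interior_of_mono)
      qed
      have KH: "?int R \<inter> ?int S = {}" if "R \<in> K" "S \<in> H" for R S
        using intK[OF that(1)] insert.prems(6)[of Q S] that(2) by auto
      have ne: "?int R \<noteq> {}" if "R \<in> K" for R
        using interior_dyadic_nonempty[OF n l] that K(2) b(4) by blast
      have "K \<inter> H = {}" using KH ne by blast
      then have "sum g K + ((\<Sum>Q\<in>G. family_sup n g Q) + sum g H) =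
          (\<Sum>Q\<in>G. family_sup n g Q) + sum g (K \<union> H)"
        using K insert.prems by (simp add: sum.union_disjoint ac_simps)
      also have "\<dots> \<le> family_sup n g (cube n a l)"
      proof (rule insert.IH)
        show "almost_disjoint n (K \<union> H)"
          using K(3) insert.prems(5) KH unfolding pairwise_def disjnt_def by blast
        fix P R assume "P \<in> G" "R \<in> K \<union> H"
        then show "?int P \<inter> ?int R = {}"
          using insert.prems(6)[of P R] intK[of R] GQ[of P] by auto
      qed (use K b insert.prems in \<open>auto simp: pairwise_insert\<close>)
      finally show "sum g K + ((\<Sum>Q\<in>G. family_sup n g Q) + sum g H) \<le> family_sup n g (cube n a l)" .
    qed
    then show ?case using insert.hyps by (simp add: add.assoc)
  qed
  from this[of "{}"] show ?thesis by (simp add: pairwise_def)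
qed

section \<open>Integration of the weak type estimate\<close>

lemma nn_integral_le_dyadic_levels:
  assumes h [measurable]: "h \<in> borel_measurable M" and A: "0 < A"
  shows "(\<integral>\<^sup>+x. h x \<partial>M) \<le> ennreal A * emeasure M (space M) +
    (\<Sum>k. ennreal (2 * 2 ^ k * A) * emeasure M {x \<in> space M. h x > ennreal (2 ^ k * A)})"
proof -
  define D where "D k = {x \<in> space M. h x > ennreal (2 ^ k * A)}" for k :: nat
  have D [measurable]: "D k \<in> sets M" for k unfolding D_def by measurable
  define g where "g x k = ennreal (2 * 2 ^ k * A) * indicator (D k) x" for x and k :: nat
  \<comment> \<open>A value above \<open>A\<close> lies in some interval from
    \<open>2 ^ i * A\<close> to \<open>2 ^ (i + 1) * A\<close>, whose upper end is the i-th term. An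
    infinite value exceeds every level, and the terms are unbounded.\<close>
  have "h x \<le> ennreal A + (\<Sum>k. g x k)" if x: "x \<in> space M" for x
  proof -
    have term_le: "ennreal (2 * 2 ^ k * A) \<le> (\<Sum>k. g x k)" if "h x > ennreal (2 ^ k * A)" for k
    proof -
      have "g x k = ennreal (2 * 2 ^ k * A)" using that x by (simp add: g_def D_def)
      then show ?thesis using sum_le_suminf[OF summableI, of "{k}" "g x"] by simp
    qed
    show ?thesis
    proof (cases "h x")
      case (real y)
      show ?thesis
      proof (cases "y \<le> A")
        case True
        then show ?thesis using real by (simp add: add_increasing2 ennreal_leI)
      next
        case False
        obtain N where "y / A < 2 ^ N" using real_arch_pow[of 2 "y / A"] by auto
        then have N: "y \<le> 2 ^ N * A" using A by (simp add: field_simps)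
        define k where "k = (LEAST k. y \<le> 2 ^ k * A)"
        have k: "y \<le> 2 ^ k * A" unfolding k_def by (rule LeastI, rule N)
        with False have "k \<noteq> 0" by (cases k) auto
        then obtain i where i: "k = Suc i" by (cases k) auto
        then have "\<not> y \<le> 2 ^ i * A" using not_less_Least[of i "\<lambda>k. y \<le> 2 ^ k * A"] by (auto simp: k_def)
        then have "ennreal (2 ^ i * A) < h x" using real A by (simp add: ennreal_less_iff)
        then have "ennreal (2 * 2 ^ i * A) \<le> (\<Sum>k. g x k)" by (rule term_le)
        moreover have "h x \<le> ennreal (2 * 2 ^ i * A)" using k i real by (simp add: ennreal_leI)
        ultimately show ?thesis by (meson add_increasing order_trans zero_le)
      qed
    next
      case top
      have "(\<Sum>k. g x k) = top"
      proof (cases "\<Sum>k. g x k")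
        case (real z)
        obtain N where "z / A < 2 ^ N" using real_arch_pow[of 2 "z / A"] by auto
        then have N: "z < 2 ^ N * A" using A by (simp add: field_simps)
        have "ennreal (2 * 2 ^ N * A) \<le> ennreal z" using term_le[of N] top real by simp
        then have "2 * 2 ^ N * A \<le> z" using real(1) by (simp add: ennreal_le_iff)
        moreover have "0 < 2 ^ N * A" using A by simp
        ultimately show ?thesis using N by linarith
      qed
      then show ?thesis by simp
    qed
  qed
  then have "(\<integral>\<^sup>+x. h x \<partial>M) \<le> (\<integral>\<^sup>+x. ennreal A + (\<Sum>k. g x k) \<partial>M)"
    by (rule nn_integral_mono)
  also have "\<dots> = ennreal A * emeasure M (space M) + (\<Sum>k. \<integral>\<^sup>+x. g x k \<partial>M)"
    unfolding g_def by (subst nn_integral_add) (auto simp: nn_integral_suminf)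
  also have "(\<lambda>k. \<integral>\<^sup>+x. g x k \<partial>M) = (\<lambda>k. ennreal (2 * 2 ^ k * A) * emeasure M (D k))"
    unfolding g_def by (simp add: nn_integral_cmult_indicator)
  finally show ?thesis by (simp add: D_def)
qed

text \<open>At level \<open>2 ^ k * A\<close> the weak bound decays like
  \<open>2 powr (- k * p)\<close> against the factor \<open>2 ^ k\<close>. The series is geometric
  with ratio \<open>2 powr (1 - p)\<close>, and it converges because \<open>p\<close> exceeds
  1.\<close>

lemma nn_integral_weak_type:
  assumes h: "h \<in> borel_measurable M" and A: "0 < A" and p: "1 < p" and W: "0 \<le> W"
    and weak: "\<And>t. 0 < t \<Longrightarrow> emeasure M {x \<in> space M. h x > ennreal t} \<le> ennreal (W / t powr p)"
  shows "(\<integral>\<^sup>+x. h x \<partial>M) \<le>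
    ennreal A * emeasure M (space M) + ennreal (2 / (1 - 2 powr (1 - p)) * (W / A powr p) * A)"
proof -
  define q where "q = 2 powr (1 - p)"
  have q: "0 \<le> q" "q < 1" using p powr_less_mono[of "1 - p" 0 2] by (auto simp: q_def)
  have "ennreal (2 * 2 ^ k * A) * emeasure M {x \<in> space M. h x > ennreal (2 ^ k * A)} \<le>
      ennreal (2 * (W / A powr p) * A * q ^ k)" for k
  proof -
    have "ennreal (2 * 2 ^ k * A) * emeasure M {x \<in> space M. h x > ennreal (2 ^ k * A)} \<le>
        ennreal (2 * 2 ^ k * A) * ennreal (W / (2 ^ k * A) powr p)"
      using A by (intro mult_left_mono weak) auto
    also have "\<dots> = ennreal (2 * 2 ^ k * A * (W / (2 ^ k * A) powr p))"
      using A W by (intro ennreal_mult[symmetric]) auto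
    also have "2 * 2 ^ k * A * (W / (2 ^ k * A) powr p) = 2 * (W / A powr p) * A * (2 ^ k / (2 ^ k) powr p)"
      using A by (simp add: powr_mult mult_ac)
    also have "2 ^ k / (2 ^ k) powr p = q ^ k"
    proof -
      have "(2::real) ^ k = 2 powr real k" by (simp add: powr_realpow)
      then have "(2::real) ^ k / (2 ^ k) powr p = 2 powr (real k - real k * p)"
        by (simp add: powr_powr powr_diff)
      also have "\<dots> = q ^ k" by (simp add: q_def powr_powr[symmetric] powr_realpow[symmetric] algebra_simps)
          (simp add: powr_powr algebra_simps)
      finally show ?thesis .
    qed
    finally show ?thesis .
  qed
  then have "(\<Sum>k. ennreal (2 * 2 ^ k * A) * emeasure M {x \<in> space M. h x > ennreal (2 ^ k * A)})
      \<le> (\<Sum>k. ennreal (2 * (W / A powr p) * A * q ^ k))"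
    by (intro suminf_le summableI)
  also have "\<dots> = ennreal (\<Sum>k. 2 * (W / A powr p) * A * q ^ k)"
    by (rule suminf_ennreal2) (use q A W in \<open>auto intro!: summable_mult summable_geometric\<close>)
  also have "(\<Sum>k. 2 * (W / A powr p) * A * q ^ k) = 2 / (1 - q) * (W / A powr p) * A"
    using q by (subst suminf_mult) (auto simp: suminf_geometric summable_geometric)
  finally show ?thesis
    using nn_integral_le_dyadic_levels[OF h A] unfolding q_def by (meson add_left_mono order_trans)
qed

lemma family_sup_ge:
  assumes "1 \<le> n" "0 < l"
  shows "g (cube n a l) \<le> family_sup n g (cube n a l)"
  using sum_le_family_sup[of "{cube n a l}" n "cube n a l" g] cube_in_dyadic[OF assms] by simp

text \<open>The cube alone is an admissible family, so its median oscillation is finite and any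
  larger \<open>d\<close> will do. This is what makes the median a real number later.\<close>

lemma ex_median_near:
  assumes n: "1 \<le> n" and l: "0 < l" and f: "f \<in> meas_on n (cube n a l)"
    and S: "family_sup n (\<lambda>Q. emeasure (leb n) Q * epowr (median_osc n s f Q) p) (cube n a l) < \<infinity>"
  obtains c d where "emeasure (leb n) {x \<in> cube n a l. \<bar>f x - ereal c\<bar> > ereal d}
      < ennreal s * emeasure (leb n) (cube n a l)"
proof -
  let ?Q = "cube n a l"
  have "emeasure (leb n) ?Q * epowr (median_osc n s f ?Q) p < \<infinity>"
    using family_sup_ge[OF n l] S by (rule le_less_trans)
  then have "median_osc n s f ?Q \<noteq> top"
    using l by (auto simp: emeasure_cube ennreal_mult_top)
  then obtain w where "median_osc n s f ?Q = ennreal w" "0 \<le> w"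
    by (cases "median_osc n s f ?Q") auto
  then have "median_osc n s f ?Q < ennreal (w + 1)" by (simp add: ennreal_less_iff)
  from median_osc_less[OF cube_sets f this] that show thesis .
qed

lemma weak_type_median:
  assumes n: "1 \<le> n" and l: "0 < l" and p: "1 < p" and s: "0 < s" "s \<le> 1 / 2 ^ (n + 3)"
    and r: "s \<le> r" "r \<le> 1 / 2" and f: "f \<in> meas_on n (cube n a l)" and T: "0 \<le> T"
    and S: "family_sup n (\<lambda>Q. emeasure (leb n) Q * epowr (median_osc n s f Q) p) (cube n a l) \<le> ennreal T"
  obtains m where "max_median n r f (cube n a l) = ereal m"
    "\<And>t. 0 < t \<Longrightarrow> emeasure (leb n) {x \<in> cube n a l. \<bar>f x - ereal m\<bar> > ereal t}
      \<le> ennreal (weak_const p * T / t powr p)"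
proof -
  let ?Q = "cube n a l"
  have fin: "emeasure (leb n) ?Q < \<infinity>" using l by (simp add: emeasure_cube)
  note near = max_median_near[OF cube_sets fin f s(1) r]
  obtain c d where "emeasure (leb n) {x \<in> ?Q. \<bar>f x - ereal c\<bar> > ereal d} < ennreal s * emeasure (leb n) ?Q"
    by (rule ex_median_near[OF n l f le_less_trans[OF S]]) auto
  from near[OF this] obtain m where m: "max_median n r f ?Q = ereal m"
    by (cases "max_median n r f ?Q") auto
  have "\<bar>c - m\<bar> \<le> d"
    if "emeasure (leb n) {x \<in> ?Q. \<bar>f x - ereal c\<bar> > ereal d} < ennreal s * emeasure (leb n) ?Q" for c d
    using near[OF that] by (auto simp: m)
  then have "emeasure (leb n) {x \<in> ?Q. \<bar>f x - ereal m\<bar> > ereal t} \<le> ennreal (weak_const p * T / t powr p)"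
    if "0 < t" for t
    using weak_type_cube[OF n l p s f T that S] by blast
  with m that show thesis by blast
qed

section \<open>From the weak type estimate to mean oscillation\<close>

lemma ennreal_less_e2ennreal_iff: "0 \<le> t \<Longrightarrow> ennreal t < e2ennreal y \<longleftrightarrow> ereal t < y"
  by (cases y) (auto simp: ennreal_less_iff e2ennreal_neg)

lemma space_restrict_leb: "Q \<in> sets (leb n) \<Longrightarrow> space (restrict_space (leb n) Q) = Q"
  using sets.sets_into_space[of Q "leb n"] by (auto simp: space_restrict_space)

lemma emeasure_restrict_leb:
  "Q \<in> sets (leb n) \<Longrightarrow> A \<subseteq> Q \<Longrightarrow> emeasure (restrict_space (leb n) Q) A = emeasure (leb n) A"
  by (intro emeasure_restrict_space) (auto intro: sets.Int)

lemma nn_integral_restrict_leb: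
  "Q \<in> sets (leb n) \<Longrightarrow> (\<integral>\<^sup>+x\<in>Q. g x \<partial>leb n) = (\<integral>\<^sup>+x. g x \<partial>restrict_space (leb n) Q)"
  by (intro nn_integral_restrict_space[symmetric]) (auto intro: sets.Int)

lemma measurable_dev:
  assumes "f \<in> meas_on n Q"
  shows "(\<lambda>x. e2ennreal \<bar>f x - ereal c\<bar>) \<in> borel_measurable (restrict_space (leb n) Q)"
proof -
  have "(\<lambda>x. e2ennreal \<bar>f x - ereal c\<bar>) \<in> borel_measurable N" if [measurable]: "f \<in> borel_measurable N" for N
    by measurable
  then show ?thesis using assms by (simp add: meas_on_def)
qed

definition layer_const :: "real \<Rightarrow> real" where
  "layer_const p = 1 + 2 / (1 - 2 powr (1 - p))"

lemma layer_const_pos: "1 < p \<Longrightarrow> 0 < layer_const p"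
  using powr_less_mono[of "1 - p" 0 2] by (simp add: layer_const_def add_pos_nonneg)

lemma weak_const_pos: "1 < p \<Longrightarrow> 0 < weak_const p"
  using powr_less_mono[of 0 "1 / p" 2] by (simp add: weak_const_def)

lemma nn_integral_dev_le:
  assumes l: "0 < l" and p: "1 < p" and f: "f \<in> meas_on n (cube n a l)" and W: "0 < W"
    and weak: "\<And>t. 0 < t \<Longrightarrow> emeasure (leb n) {x \<in> cube n a l. \<bar>f x - ereal m\<bar> > ereal t} \<le> ennreal (W / t powr p)"
  shows "(\<integral>\<^sup>+x\<in>cube n a l. e2ennreal \<bar>f x - ereal m\<bar> \<partial>leb n)
    \<le> ennreal (layer_const p * (W / l ^ n) powr (1 / p) * l ^ n)"
proof -
  let ?Q = "cube n a l" and ?M = "restrict_space (leb n) (cube n a l)"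
  \<comment> \<open>This level equates \<open>W / A powr p\<close> with the volume
    \<open>l ^ n\<close>. Both terms of the integral bound become multiples of
    \<open>A * l ^ n\<close>, and \<open>layer_const p\<close> is the sum of their
    coefficients.\<close>
  define A where "A = (W / l ^ n) powr (1 / p)"
  have A: "0 < A" "W / A powr p = l ^ n" using W l p by (auto simp: A_def powr_powr)
  have pos: "0 < 2 / (1 - 2 powr (1 - p))" using p powr_less_mono[of "1 - p" 0 2] by simp
  have "(\<integral>\<^sup>+x. e2ennreal \<bar>f x - ereal m\<bar> \<partial>?M) \<le>
    ennreal A * emeasure ?M (space ?M) + ennreal (2 / (1 - 2 powr (1 - p)) * (W / A powr p) * A)"
  proof (rule nn_integral_weak_type[OF measurable_dev[OF f] A(1) p])
    fix t :: real assume t: "0 < t"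
    have "{x \<in> space ?M. e2ennreal \<bar>f x - ereal m\<bar> > ennreal t} = {x \<in> ?Q. \<bar>f x - ereal m\<bar> > ereal t}"
      using t by (simp add: space_restrict_leb ennreal_less_e2ennreal_iff)
    with weak[OF t] show "emeasure ?M {x \<in> space ?M. e2ennreal \<bar>f x - ereal m\<bar> > ennreal t} \<le> ennreal (W / t powr p)"
      by (simp add: emeasure_restrict_leb)
  qed (use W in simp)
  also have "\<dots> = ennreal A * ennreal (l ^ n) + ennreal (2 / (1 - 2 powr (1 - p)) * l ^ n * A)"
    using l by (simp only: A(2) space_restrict_leb[OF cube_sets] emeasure_restrict_leb[OF cube_sets order_refl] emeasure_cube)
  also have "\<dots> = ennreal (A * l ^ n + 2 / (1 - 2 powr (1 - p)) * l ^ n * A)"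
    using l A(1) pos by (subst ennreal_plus) (auto simp: ennreal_mult)
  also have "A * l ^ n + 2 / (1 - 2 powr (1 - p)) * l ^ n * A = layer_const p * A * l ^ n"
    by (simp add: layer_const_def distrib_left distrib_right mult_ac)
  finally show ?thesis by (simp add: A_def nn_integral_restrict_leb)
qed

lemma L1_onI_dev:
  assumes Q: "Q \<in> sets (leb n)" "emeasure (leb n) Q < \<infinity>" and f: "f \<in> meas_on n Q"
    and fin: "(\<integral>\<^sup>+x\<in>Q. e2ennreal \<bar>f x - ereal m\<bar> \<partial>leb n) < \<infinity>"
  shows "f \<in> L1_on n Q"
proof -
  let ?M = "restrict_space (leb n) Q"
  have "e2ennreal \<bar>f x\<bar> \<le> e2ennreal \<bar>f x - ereal m\<bar> + ennreal \<bar>m\<bar>" for x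
    by (cases "f x") (auto simp: ennreal_le_iff simp flip: ennreal_plus)
  then have "(\<integral>\<^sup>+x. e2ennreal \<bar>f x\<bar> \<partial>?M) \<le> (\<integral>\<^sup>+x. e2ennreal \<bar>f x - ereal m\<bar> + ennreal \<bar>m\<bar> \<partial>?M)"
    by (intro nn_integral_mono)
  also have "\<dots> = (\<integral>\<^sup>+x. e2ennreal \<bar>f x - ereal m\<bar> \<partial>?M) + ennreal \<bar>m\<bar> * emeasure ?M (space ?M)"
    using measurable_dev[OF f] by (subst nn_integral_add) auto
  also have "\<dots> < \<infinity>"
    using fin Q by (simp add: nn_integral_restrict_leb space_restrict_leb emeasure_restrict_leb ennreal_mult_less_top)
  finally show ?thesis using f Q by (simp add: L1_on_def nn_integral_restrict_leb)
qed

text \<open>The average differs from \<open>m\<close> by at most the mean of the deviation from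
  \<open>m\<close>, so replacing \<open>m\<close> by the average costs a factor 2. Integrability
  makes \<open>f\<close> finite almost everywhere, so the computation can be done with a real-valued
  function.\<close>

lemma mean_osc_le:
  assumes Q: "Q \<in> sets (leb n)" "0 < emeasure (leb n) Q" "emeasure (leb n) Q < \<infinity>"
    and f: "f \<in> L1_on n Q"
  shows "mean_osc n f Q \<le> 2 * (\<integral>\<^sup>+x\<in>Q. e2ennreal \<bar>f x - ereal m\<bar> \<partial>leb n) / emeasure (leb n) Q"
proof -
  let ?M = "restrict_space (leb n) Q"
  interpret finite_measure ?M
    using Q by (intro finite_measureI) (simp add: space_restrict_leb emeasure_restrict_leb)
  define g where "g x = real_of_ereal (f x)" for x
  have fM [measurable]: "f \<in> borel_measurable ?M" using f by (simp add: L1_on_def meas_on_def)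
  have gM [measurable]: "g \<in> borel_measurable ?M" unfolding g_def by measurable
  have fin: "(\<integral>\<^sup>+x. e2ennreal \<bar>f x\<bar> \<partial>?M) < \<infinity>"
    using f Q by (simp add: L1_on_def nn_integral_restrict_leb)
  then have "AE x in ?M. e2ennreal \<bar>f x\<bar> \<noteq> \<infinity>"
    by (intro nn_integral_PInf_AE) auto
  then have AE: "AE x in ?M. f x = ereal (g x)"
    by eventually_elim (auto simp: g_def, metis abs_ereal.simps(2,3) e2ennreal_infty ereal_real' infinity_ennreal_def)
  have "(\<integral>\<^sup>+x. ennreal (norm (g x)) \<partial>?M) = (\<integral>\<^sup>+x. e2ennreal \<bar>f x\<bar> \<partial>?M)"
    by (rule nn_integral_cong_AE) (use AE in eventually_elim, auto)
  then have gi [simp]: "integrable ?M g"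
    using fin by (intro integrableI_bounded gM) simp
  have dev: "(\<integral>\<^sup>+x. e2ennreal \<bar>f x - ereal c\<bar> \<partial>?M) = ennreal (\<integral>x. \<bar>g x - c\<bar> \<partial>?M)" for c
  proof -
    have "(\<integral>\<^sup>+x. e2ennreal \<bar>f x - ereal c\<bar> \<partial>?M) = (\<integral>\<^sup>+x. ennreal \<bar>g x - c\<bar> \<partial>?M)"
      by (rule nn_integral_cong_AE) (use AE in eventually_elim, auto)
    also have "\<dots> = ennreal (\<integral>x. \<bar>g x - c\<bar> \<partial>?M)"
      by (rule nn_integral_eq_integral) auto
    finally show ?thesis .
  qed
  define V where "V = measure (leb n) Q"
  have V: "0 < V" "emeasure (leb n) Q = ennreal V" "measure ?M (space ?M) = V"
    using Q by (auto simp: V_def measure_def enn2real_positive_iff space_restrict_leb emeasure_restrict_leb)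
  have avg: "avg n f Q = (\<integral>x. g x \<partial>?M) / V"
    unfolding avg_def set_lebesgue_integral_def V_def g_def
    using Q by (subst integral_restrict_space) (auto intro: sets.Int)
  have "(avg n f Q - m) * V = (\<integral>x. g x - m \<partial>?M)"
    using V by (simp add: avg field_simps)
  then have "\<bar>avg n f Q - m\<bar> * V = \<bar>\<integral>x. g x - m \<partial>?M\<bar>"
    using V(1) by (metis abs_mult abs_of_pos)
  also have "\<dots> \<le> (\<integral>x. \<bar>g x - m\<bar> \<partial>?M)" by (rule integral_abs_bound)
  finally have *: "\<bar>avg n f Q - m\<bar> * V \<le> (\<integral>x. \<bar>g x - m\<bar> \<partial>?M)" .
  have "(\<integral>x. \<bar>g x - avg n f Q\<bar> \<partial>?M) \<le> (\<integral>x. \<bar>g x - m\<bar> + \<bar>avg n f Q - m\<bar> \<partial>?M)"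
    by (rule integral_mono) auto
  also have "\<dots> = (\<integral>x. \<bar>g x - m\<bar> \<partial>?M) + \<bar>avg n f Q - m\<bar> * V"
    using V by simp
  finally have "(\<integral>x. \<bar>g x - avg n f Q\<bar> \<partial>?M) \<le> 2 * (\<integral>x. \<bar>g x - m\<bar> \<partial>?M)" using * by simp
  then have "(\<integral>\<^sup>+x. e2ennreal \<bar>f x - ereal (avg n f Q)\<bar> \<partial>?M) \<le> 2 * (\<integral>\<^sup>+x. e2ennreal \<bar>f x - ereal m\<bar> \<partial>?M)"
    unfolding dev by (subst ennreal_numeral[symmetric], subst ennreal_mult[symmetric]) (auto intro: ennreal_leI)
  then show ?thesis
    unfolding mean_osc_def using Q by (simp add: nn_integral_restrict_leb divide_right_mono_ennreal)
qed

definition strong_const :: "real \<Rightarrow> real" where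
  "strong_const p = 2 * layer_const p * weak_const p powr (1 / p)"

lemma strong_const_pos: "1 < p \<Longrightarrow> 0 < strong_const p"
  using weak_const_pos[of p] layer_const_pos[of p] by (simp add: strong_const_def)

text \<open>The sum is bounded by a positive \<open>T\<close> instead of being used itself: it may
  vanish, while the level \<open>A\<close> at which the integral is split has to be
  positive.\<close>

lemma mean_osc_power_le_pos:
  assumes n: "1 \<le> n" and l: "0 < l" and p: "1 < p" and s: "0 < s" "s \<le> 1 / 2 ^ (n + 3)"
    and f: "f \<in> meas_on n (cube n a l)" and T: "0 < T"
    and S: "family_sup n (\<lambda>Q. emeasure (leb n) Q * epowr (median_osc n s f Q) p) (cube n a l) \<le> ennreal T"
  shows "f \<in> L1_on n (cube n a l)"
    and "emeasure (leb n) (cube n a l) * epowr (mean_osc n f (cube n a l)) p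
      \<le> ennreal (strong_const p powr p) * ennreal T"
proof -
  let ?Q = "cube n a l"
  define V where "V = l ^ n"
  have V: "0 < V" "emeasure (leb n) ?Q = ennreal V" using l by (auto simp: V_def emeasure_cube)
  define W where "W = weak_const p * T"
  have W: "0 < W" using weak_const_pos[OF p] T by (simp add: W_def)
  define A where "A = (W / V) powr (1 / p)"
  have A: "0 < A" "A powr p = W / V" using W V p by (auto simp: A_def powr_powr)
  have L: "0 < layer_const p" by (rule layer_const_pos[OF p])
  have "(1::real) / 2 ^ (n + 3) \<le> 1 / 2 ^ 1" by (intro divide_left_mono power_increasing) auto
  with s(2) have s2: "s \<le> 1 / 2" unfolding power_one_right by (rule order_trans)
  obtain m where "max_median n s f ?Q = ereal m" and m: "\<And>t. 0 < t \<Longrightarrow>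
      emeasure (leb n) {x \<in> ?Q. \<bar>f x - ereal m\<bar> > ereal t} \<le> ennreal (W / t powr p)"
    by (rule weak_type_median[OF n l p s order_refl s2 f less_imp_le[OF T] S]) (rule that, simp_all add: W_def)
  have int: "(\<integral>\<^sup>+x\<in>?Q. e2ennreal \<bar>f x - ereal m\<bar> \<partial>leb n) \<le> ennreal (layer_const p * A * V)"
    unfolding A_def V_def by (rule nn_integral_dev_le[OF l p f W m])
  show L1: "f \<in> L1_on n ?Q"
    by (rule L1_onI_dev[OF cube_sets _ f, of m]) (use V int in \<open>auto intro: le_less_trans\<close>)
  have "mean_osc n f ?Q \<le> 2 * (\<integral>\<^sup>+x\<in>?Q. e2ennreal \<bar>f x - ereal m\<bar> \<partial>leb n) / emeasure (leb n) ?Q"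
    by (rule mean_osc_le[OF cube_sets _ _ L1]) (use V in auto)
  also have "\<dots> \<le> ennreal 2 * ennreal (layer_const p * A * V) / ennreal V"
    unfolding V(2) using int by (intro divide_right_mono_ennreal mult_mono) auto
  also have "\<dots> = ennreal (2 * layer_const p * A)"
  proof -
    have "ennreal 2 * ennreal (layer_const p * A * V) = ennreal (2 * layer_const p * A * V)"
      using V A L by (subst ennreal_mult[symmetric]) auto
    also have "\<dots> / ennreal V = ennreal (2 * layer_const p * A * V / V)"
      using V A L by (intro divide_ennreal) auto
    finally show ?thesis using V by simp
  qed
  finally have "epowr (mean_osc n f ?Q) p \<le> epowr (ennreal (2 * layer_const p * A)) p"
    using p by (intro epowr_mono) auto
  also have "\<dots> = ennreal ((2 * layer_const p) powr p * (W / V))"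
    using A L by (simp add: powr_mult)
  finally have "emeasure (leb n) ?Q * epowr (mean_osc n f ?Q) p \<le> ennreal V * ennreal ((2 * layer_const p) powr p * (W / V))"
    unfolding V(2) by (intro mult_left_mono) auto
  also have "\<dots> = ennreal (strong_const p powr p * T)"
    using V W L weak_const_pos[OF p] p unfolding strong_const_def
    by (simp add: powr_mult powr_powr W_def mult.assoc flip: ennreal_mult)
  also have "\<dots> = ennreal (strong_const p powr p) * ennreal T"
    using T by (simp add: ennreal_mult)
  finally show "emeasure (leb n) ?Q * epowr (mean_osc n f ?Q) p \<le> ennreal (strong_const p powr p) * ennreal T" .
qed

lemma mean_osc_power_le:
  assumes n: "1 \<le> n" and l: "0 < l" and p: "1 < p" and s: "0 < s" "s \<le> 1 / 2 ^ (n + 3)"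
    and f: "f \<in> meas_on n (cube n a l)"
  shows "emeasure (leb n) (cube n a l) * epowr (mean_osc n f (cube n a l)) p \<le> ennreal (strong_const p powr p) *
    family_sup n (\<lambda>Q. emeasure (leb n) Q * epowr (median_osc n s f Q) p) (cube n a l)"
    (is "?x \<le> ennreal ?K * ?S")
proof (cases ?S)
  case (real z)
  have K: "0 < ?K" using strong_const_pos[OF p] by simp
  show ?thesis
  proof (rule ennreal_le_epsilon)
    fix e :: real assume e: "0 < e"
    \<comment> \<open>The excess \<open>e / ?K\<close> keeps the bound positive and contributes
      exactly \<open>e\<close> after multiplication by \<open>?K\<close>.\<close>
    have "?x \<le> ennreal ?K * ennreal (z + e / ?K)"
      by (rule mean_osc_power_le_pos[OF n l p s f]) (use e K real in \<open>auto intro: add_nonneg_pos ennreal_leI\<close>)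
    also have "\<dots> = ennreal ?K * ?S + ennreal e"
      using e K real by (simp add: distrib_left flip: ennreal_mult ennreal_plus)
    finally show "?x \<le> ennreal ?K * ?S + ennreal e" .
  qed
next
  case top
  then show ?thesis using strong_const_pos[OF p] by (simp add: ennreal_mult_top)
qed

section \<open>The two norm inequalities\<close>

lemma epowr_mult: "0 < k \<Longrightarrow> 0 < p \<Longrightarrow> epowr (ennreal k * x) p = ennreal (k powr p) * epowr x p"
  by (cases x) (auto simp: powr_mult ennreal_mult_top simp flip: ennreal_mult)

lemma family_sup_cmult_mono:
  assumes "\<And>F. finite F \<Longrightarrow> F \<subseteq> dyadic n Q0 \<Longrightarrow> almost_disjoint n F \<Longrightarrow> k * sum g F \<le> T"
  shows "k * family_sup n g Q0 \<le> T"
  unfolding family_sup_eq by (subst SUP_mult_left_ennreal) (auto intro!: SUP_least assms)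

text \<open>Chebyshev's inequality with the average as the competing constant. The intermediate
  value \<open>y\<close> supplies the strict inequality in the definition of the median, and the
  level is \<open>a = y / s\<close>.\<close>

lemma median_osc_le_mean_osc:
  assumes Q: "Q \<in> sets (leb n)" "0 < emeasure (leb n) Q" "emeasure (leb n) Q < \<infinity>"
    and f: "f \<in> meas_on n Q" and s: "0 < s"
  shows "ennreal s * median_osc n s f Q \<le> mean_osc n f Q"
proof (rule ccontr)
  assume "\<not> ?thesis"
  then obtain y where y: "mean_osc n f Q < y" "y < ennreal s * median_osc n s f Q"
    by (auto simp: not_le dest: dense)
  then obtain r where r: "y = ennreal r" "0 \<le> r" by (cases y) auto
  define a where "a = r / s"
  have a: "0 < a" "ennreal s * ennreal a = y"
    using r s y(1) by (auto simp: a_def simp flip: ennreal_mult intro!: divide_pos_pos) (metis ennreal_0 not_gr_zero not_less_zero order_le_less)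
  define b where "b = avg n f Q"
  let ?D = "{x \<in> Q. \<bar>f x - ereal b\<bar> > ereal a}"
  have D: "?D \<in> sets (leb n)" by (rule meas_on_dev_sets[OF Q(1) f])
  have "ennreal a * emeasure (leb n) ?D = (\<integral>\<^sup>+x. ennreal a * indicator ?D x \<partial>leb n)"
    using D by (simp add: nn_integral_cmult_indicator)
  also have "\<dots> \<le> (\<integral>\<^sup>+x\<in>Q. e2ennreal \<bar>f x - ereal b\<bar> \<partial>leb n)"
    using a(1) ennreal_less_e2ennreal_iff[of a]
    by (intro nn_integral_mono) (auto simp: indicator_def less_imp_le)
  also have "\<dots> = mean_osc n f Q * emeasure (leb n) Q"
    using Q by (simp add: mean_osc_def b_def ennreal_divide_times ennreal_mult_divide_eq)
  also have "\<dots> < y * emeasure (leb n) Q"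
    using y(1) Q by (intro ennreal_mult_strict_right_mono) auto
  also have "\<dots> = ennreal a * (ennreal s * emeasure (leb n) Q)"
    by (simp add: a(2)[symmetric] mult_ac)
  finally have "emeasure (leb n) ?D < ennreal s * emeasure (leb n) Q"
    by (meson mult_left_mono not_le zero_le)
  then have "max_median n s (\<lambda>x. \<bar>f x - ereal b\<bar>) Q \<le> ereal a"
    unfolding max_median_def by (intro Inf_lower) auto
  then have "(INF c::real. max_median n s (\<lambda>x. \<bar>f x - ereal c\<bar>) Q) \<le> ereal a"
    by (intro INF_lower2[of b]) auto
  then have "median_osc n s f Q \<le> e2ennreal (ereal a)"
    unfolding median_osc_def by (rule e2ennreal_mono)
  then have "ennreal s * median_osc n s f Q \<le> y"
    unfolding a(2)[symmetric] by (intro mult_left_mono) auto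
  with y(2) show False by simp
qed

text \<open>The weak type estimate is applied in each cube of the family separately, with that
  cube's own median. Each summand is thereby controlled by the supremum over subcubes of that cube,
  and superadditivity collects these local suprema.\<close>

lemma JN_norm_le:
  assumes n: "1 \<le> n" and l: "0 < l" and p: "1 < p" and s: "0 < s" "s \<le> 1 / 2 ^ (n + 3)"
    and f: "f \<in> meas_on n (cube n a l)"
  shows "JN_norm n p (cube n a l) f \<le> ennreal (strong_const p) * JN_median_norm n p s (cube n a l) f"
proof -
  let ?Q0 = "cube n a l"
  let ?g = "\<lambda>Q. emeasure (leb n) Q * epowr (median_osc n s f Q) p"
  have c: "0 < strong_const p" by (rule strong_const_pos[OF p])
  show ?thesis
  proof (cases "family_sup n ?g ?Q0")
    case top
    then show ?thesis using c by (simp add: JN_median_norm_eq ennreal_mult_top)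
  next
    case (real z)
    have L1: "f \<in> L1_on n ?Q0"
      by (rule mean_osc_power_le_pos(1)[OF n l p s f, of "z + 1"]) (use real in \<open>auto intro: ennreal_leI\<close>)
    have "family_sup n (\<lambda>Q. emeasure (leb n) Q * epowr (mean_osc n f Q) p) ?Q0
        \<le> ennreal (strong_const p powr p) * family_sup n ?g ?Q0"
    proof (rule family_sup_leI)
      fix F assume F: "finite F" "F \<subseteq> dyadic n ?Q0" "almost_disjoint n F"
      have "emeasure (leb n) Q * epowr (mean_osc n f Q) p \<le> ennreal (strong_const p powr p) * family_sup n ?g Q"
        if Q: "Q \<in> F" for Q
      proof -
        obtain b l' where b: "0 < l'" "Q = cube n b l'" "Q \<subseteq> ?Q0" "dyadic n Q \<subseteq> dyadic n ?Q0"
          using F(2) Q by (blast intro: dyadic_subcube[OF n l])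
        show ?thesis
          using mean_osc_power_le[OF n b(1) p s, of f b] meas_on_subset[OF f b(3)] by (simp add: b(2))
      qed
      then have "(\<Sum>Q\<in>F. emeasure (leb n) Q * epowr (mean_osc n f Q) p)
          \<le> ennreal (strong_const p powr p) * (\<Sum>Q\<in>F. family_sup n ?g Q)"
        unfolding sum_distrib_left by (rule sum_mono)
      also have "\<dots> \<le> ennreal (strong_const p powr p) * family_sup n ?g ?Q0"
        by (intro mult_left_mono sum_family_sup_le[OF n l F]) auto
      finally show "(\<Sum>Q\<in>F. emeasure (leb n) Q * epowr (mean_osc n f Q) p)
          \<le> ennreal (strong_const p powr p) * family_sup n ?g ?Q0" .
    qed
    then have "JN_norm n p ?Q0 f \<le> epowr (ennreal (strong_const p powr p) * family_sup n ?g ?Q0) (1 / p)"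
      unfolding JN_norm_eq[OF L1] using p by (intro epowr_mono) auto
    also have "\<dots> = ennreal (strong_const p) * JN_median_norm n p s ?Q0 f"
      using c p by (simp add: epowr_mult powr_powr JN_median_norm_eq)
    finally show ?thesis .
  qed
qed

lemma JN_median_norm_le:
  assumes n: "1 \<le> n" and l: "0 < l" and p: "1 < p" and s: "0 < s" and f: "f \<in> meas_on n (cube n a l)"
  shows "ennreal s * JN_median_norm n p s (cube n a l) f \<le> JN_norm n p (cube n a l) f"
proof (cases "f \<in> L1_on n (cube n a l)")
  case True
  let ?Q0 = "cube n a l"
  let ?h = "\<lambda>Q. emeasure (leb n) Q * epowr (mean_osc n f Q) p"
  have le: "ennreal (s powr p) * family_sup n (\<lambda>Q. emeasure (leb n) Q * epowr (median_osc n s f Q) p) ?Q0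
      \<le> family_sup n ?h ?Q0"
  proof (rule family_sup_cmult_mono)
    fix F assume F: "finite F" "F \<subseteq> dyadic n ?Q0" "almost_disjoint n F"
    have "ennreal (s powr p) * (emeasure (leb n) Q * epowr (median_osc n s f Q) p) \<le> ?h Q" if Q: "Q \<in> F" for Q
    proof -
      obtain b l' where b: "0 < l'" "Q = cube n b l'" "Q \<subseteq> ?Q0" "dyadic n Q \<subseteq> dyadic n ?Q0"
        using F(2) Q by (blast intro: dyadic_subcube[OF n l])
      have "ennreal s * median_osc n s f Q \<le> mean_osc n f Q"
        by (rule median_osc_le_mean_osc[OF _ _ _ meas_on_subset[OF f b(3)] s])
           (use b(1) in \<open>auto simp: b(2) emeasure_cube\<close>)
      then have "epowr (ennreal s * median_osc n s f Q) p \<le> epowr (mean_osc n f Q) p"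
        using p by (intro epowr_mono) auto
      then have "emeasure (leb n) Q * (ennreal (s powr p) * epowr (median_osc n s f Q) p) \<le> ?h Q"
        using s p by (intro mult_left_mono) (auto simp: epowr_mult)
      then show ?thesis by (simp add: mult_ac)
    qed
    then have "ennreal (s powr p) * (\<Sum>Q\<in>F. emeasure (leb n) Q * epowr (median_osc n s f Q) p) \<le> sum ?h F"
      unfolding sum_distrib_left by (rule sum_mono)
    also have "\<dots> \<le> family_sup n ?h ?Q0" by (rule sum_le_family_sup[OF F])
    finally show "ennreal (s powr p) * (\<Sum>Q\<in>F. emeasure (leb n) Q * epowr (median_osc n s f Q) p)
        \<le> family_sup n ?h ?Q0" .
  qed
  have "ennreal s * JN_median_norm n p s ?Q0 f = epowr (ennreal (s powr p) *
      family_sup n (\<lambda>Q. emeasure (leb n) Q * epowr (median_osc n s f Q) p) ?Q0) (1 / p)"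
    using s p by (simp add: epowr_mult powr_powr JN_median_norm_eq)
  also have "\<dots> \<le> JN_norm n p ?Q0 f"
    unfolding JN_norm_eq[OF True] using p le by (intro epowr_mono) auto
  finally show ?thesis .
qed (simp add: JN_norm_def)

lemma weak_type_JN_median:
  assumes n: "1 \<le> n" and l: "0 < l" and p: "1 < p" and s: "0 < s" "s \<le> 1 / 2 ^ (n + 3)"
    and r: "s \<le> r" "r \<le> 1 / 2" and f: "f \<in> JN_median n p s (cube n a l)" and t: "0 < t"
    and c: "weak_const p \<le> c"
  shows "emeasure (leb n) {x \<in> cube n a l. \<bar>f x - max_median n r f (cube n a l)\<bar> > ereal t}
    \<le> ennreal c * epowr (JN_median_norm n p s (cube n a l) f) p / ennreal (t powr p)"
proof -
  let ?Q = "cube n a l"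
  let ?S = "family_sup n (\<lambda>Q. emeasure (leb n) Q * epowr (median_osc n s f Q) p) ?Q"
  have norm: "epowr (JN_median_norm n p s ?Q f) p = ?S"
    unfolding JN_median_norm_eq using p by (intro epowr_epowr) auto
  have "?S \<noteq> top"
    using f by (auto simp: JN_median_def JN_median_norm_eq)
  then obtain T where T: "?S = ennreal T" "0 \<le> T" by (cases ?S) auto
  obtain m where "max_median n r f ?Q = ereal m" "\<And>t. 0 < t \<Longrightarrow>
      emeasure (leb n) {x \<in> ?Q. \<bar>f x - ereal m\<bar> > ereal t} \<le> ennreal (weak_const p * T / t powr p)"
    by (rule weak_type_median[OF n l p s r _ T(2)]) (use f T(1) in \<open>auto simp: JN_median_def\<close>)
  then have "emeasure (leb n) {x \<in> ?Q. \<bar>f x - max_median n r f ?Q\<bar> > ereal t} \<le> ennreal (weak_const p * T / t powr p)"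
    using t by simp
  also have "\<dots> \<le> ennreal (c * T / t powr p)"
    using c T(2) by (intro ennreal_leI divide_right_mono mult_right_mono) auto
  also have "\<dots> = ennreal c * ?S / ennreal (t powr p)"
  proof -
    have "0 \<le> c" using weak_const_pos[OF p] c by simp
    then have "ennreal c * ?S = ennreal (c * T)" using T by (simp add: ennreal_mult)
    then show ?thesis using \<open>0 \<le> c\<close> T(2) t by (simp add: divide_ennreal)
  qed
  finally show ?thesis by (simp only: norm)
qed

theorem corollary3p7:
  fixes p :: real
  assumes "1 < p"
  shows "\<exists>c::real. 0 < c \<and>
    (\<forall>(n::nat) (Q0 :: (nat \<Rightarrow> real) set) (s::real).
      1 \<le> n \<and> is_cube n Q0 \<and> 0 < s \<and> s \<le> 1 / 2 ^ (n + 3) \<longrightarrow>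
        (\<forall>(r::real) f (t::real). s \<le> r \<and> r \<le> 1 / 2 \<and> f \<in> JN_median n p s Q0 \<and> 0 < t \<longrightarrow>
           emeasure (leb n) {x \<in> Q0. \<bar>f x - max_median n r f Q0\<bar> > ereal t}
             \<le> ennreal c * epowr (JN_median_norm n p s Q0 f) p / ennreal (t powr p)) \<and>
        (\<forall>f \<in> meas_on n Q0.
           ennreal s * JN_median_norm n p s Q0 f \<le> JN_norm n p Q0 f \<and>
           JN_norm n p Q0 f \<le> ennreal (2 * c * p / (p - 1)) * JN_median_norm n p s Q0 f))"
proof -
  \<comment> \<open>One constant has to serve both statements: the second entry is the value at
    which \<open>2 * c * p / (p - 1)\<close> equals \<open>strong_const p\<close>.\<close>
  define c where "c = max (weak_const p) (strong_const p * (p - 1) / (2 * p))"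
  have c: "0 < c" "weak_const p \<le> c" using weak_const_pos[OF assms] by (auto simp: c_def)
  have "strong_const p * (p - 1) / (2 * p) \<le> c" by (simp add: c_def)
  then have strong: "strong_const p \<le> 2 * c * p / (p - 1)" using assms by (simp add: field_simps)
  show ?thesis
  proof (intro exI[of _ c] conjI allI impI ballI, fact c(1))
    fix n Q0 and s r :: real and f and t :: real
    assume A: "1 \<le> n \<and> is_cube n Q0 \<and> 0 < s \<and> s \<le> 1 / 2 ^ (n + 3)"
      and B: "s \<le> r \<and> r \<le> 1 / 2 \<and> f \<in> JN_median n p s Q0 \<and> 0 < t"
    then obtain a l where Q0: "0 < l" "Q0 = cube n a l" by (auto simp: is_cube_def)
    show "emeasure (leb n) {x \<in> Q0. \<bar>f x - max_median n r f Q0\<bar> > ereal t}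
        \<le> ennreal c * epowr (JN_median_norm n p s Q0 f) p / ennreal (t powr p)"
      unfolding Q0(2) by (rule weak_type_JN_median[OF _ Q0(1) assms _ _ _ _ _ _ c(2)]) (use A B Q0 in auto)
  next
    fix n Q0 and s :: real and f
    assume A: "1 \<le> n \<and> is_cube n Q0 \<and> 0 < s \<and> s \<le> 1 / 2 ^ (n + 3)" and f: "f \<in> meas_on n Q0"
    then obtain a l where Q0: "0 < l" "Q0 = cube n a l" by (auto simp: is_cube_def)
    show "ennreal s * JN_median_norm n p s Q0 f \<le> JN_norm n p Q0 f"
      unfolding Q0(2) by (rule JN_median_norm_le) (use A f Q0 assms in auto)
    have "JN_norm n p Q0 f \<le> ennreal (strong_const p) * JN_median_norm n p s Q0 f"
      unfolding Q0(2) by (rule JN_norm_le) (use A f Q0 assms in auto)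
    also have "\<dots> \<le> ennreal (2 * c * p / (p - 1)) * JN_median_norm n p s Q0 f"
      by (intro mult_right_mono ennreal_leI strong) auto
    finally show "JN_norm n p Q0 f \<le> ennreal (2 * c * p / (p - 1)) * JN_median_norm n p s Q0 f" .
  qed
qed

end
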